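(* Let $\mathcal{A}$ and $\mathcal{B}$ be $C^{*}$-algebras, let $\Xi$ be a Hilbert $\mathcal{A}$-module and $\nabla$ a Hilbert $\mathcal{B}$-module. Let $f:\Xi \rightarrow \nabla$ be a mapping for which there exists a function $\varphi:\Xi^{3}\rightarrow[0,\infty)$ such that $$\| f(\mu x+y)-\mu f(x)-f(y)\| \leq \varphi(x,y,0)$$ and $$\| f(\langle x,y\rangle z)-\langle f(x),f(y)\rangle f(z)\| \leq \varphi(x,y,z)$$ for all $x,y,z\in\Xi$ and all $\mu\in\mathbb{T}$. If there exists $0\leq L<1$ such that $\varphi(x,y,z)\leq \frac{L}{8}\varphi(2x,2y,2z)$ for all $x,y,z\in\Xi$, then there exists a unique Hilbert $C^{*}$-module homomorphism $H:\Xi\rightarrow\nabla$ such that $$\|f(x)-H(x)\|\leq \frac{L}{8-8L}\varphi(x,x,0)$$ for all $x\in\Xi$.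
   Context: $\mathbb{T}=\{z\in\mathbb{C}:|z|=1\}$. For a $C^{*}$-algebra $\mathcal{A}$, a (left) Hilbert $\mathcal{A}$-module is a complex linear space $\Xi$ with a compatible left $\mathcal{A}$-module action ($\lambda(ax)=(\lambda a)x=a(\lambda x)$) and a map $\langle\cdot,\cdot\rangle:\Xi\times\Xi\to\mathcal{A}$ that is linear in the first variable, satisfies $\langle ax,y\rangle=a\langle x,y\rangle$, $\langle x,y\rangle^{*}=\langle y,x\rangle$, $\langle x,x\rangle\geq 0$ with equality iff $x=0$, and such that $\Xi$ is complete in the norm $\|x\|=\|\langle x,x\rangle\|^{1/2}$. For a Hilbert $\mathcal{A}$-module $\Xi$ and a Hilbert $\mathcal{B}$-module $\nabla$, a Hilbert $C^{*}$-module homomorphism is a $\mathbb{C}$-linear map $H:\Xi\to\nabla$ with $H(\langle x,y\rangle z)=\langle H(x),H(y)\rangle H(z)$ for all $x,y,z\in\Xi$. *)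

theory Defs
  imports "HOL-Analysis.Analysis"
begin

class complex_vector = real_vector +
  fixes scaleC :: "complex \<Rightarrow> 'a \<Rightarrow> 'a" (infixr \<open>*\<^sub>C\<close> 75)
  assumes scaleC_add_right: "c *\<^sub>C (x + y) = c *\<^sub>C x + c *\<^sub>C y"
    and scaleC_add_left: "(c + d) *\<^sub>C x = c *\<^sub>C x + d *\<^sub>C x"
    and scaleC_scaleC: "c *\<^sub>C (d *\<^sub>C x) = (c * d) *\<^sub>C x"
    and scaleC_one: "1 *\<^sub>C x = x"
    and scaleR_scaleC: "r *\<^sub>R x = complex_of_real r *\<^sub>C x"

class cstar_algebra = complex_vector + real_normed_algebra + banach +
  fixes cstar :: "'a \<Rightarrow> 'a"
  assumes norm_scaleC: "norm (c *\<^sub>C a) = cmod c * norm a"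
    and mult_scaleC_left: "(c *\<^sub>C a) * b = c *\<^sub>C (a * b)"
    and mult_scaleC_right: "a * (c *\<^sub>C b) = c *\<^sub>C (a * b)"
    and cstar_involutive: "cstar (cstar a) = a"
    and cstar_add: "cstar (a + b) = cstar a + cstar b"
    and cstar_scaleC: "cstar (c *\<^sub>C a) = cnj c *\<^sub>C cstar a"
    and cstar_mult: "cstar (a * b) = cstar b * cstar a"
    and cstar_identity: "norm (cstar a * a) = (norm a)\<^sup>2"

definition cstar_pos :: "'a::cstar_algebra \<Rightarrow> bool" where
  "cstar_pos a \<longleftrightarrow> (\<exists>b. a = cstar b * b)"

definition hm_norm :: "('x \<Rightarrow> 'x \<Rightarrow> 'a::cstar_algebra) \<Rightarrow> 'x \<Rightarrow> real" where
  "hm_norm ip x = sqrt (norm (ip x x))"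

definition hilbert_module ::
  "('a::cstar_algebra \<Rightarrow> 'x::complex_vector \<Rightarrow> 'x) \<Rightarrow> ('x \<Rightarrow> 'x \<Rightarrow> 'a) \<Rightarrow> bool" where
  "hilbert_module act ip \<longleftrightarrow>
     \<comment> \<open>left module structure\<close>
     (\<forall>a x y. act a (x + y) = act a x + act a y) \<and>
     (\<forall>a b x. act (a + b) x = act a x + act b x) \<and>
     (\<forall>a b x. act (a * b) x = act a (act b x)) \<and>
     \<comment> \<open>compatibility with the complex scalar multiplication\<close>
     (\<forall>c a x. c *\<^sub>C act a x = act (c *\<^sub>C a) x \<and> c *\<^sub>C act a x = act a (c *\<^sub>C x)) \<and>
     \<comment> \<open>inner product\<close>
     (\<forall>x y z. ip (x + y) z = ip x z + ip y z) \<and>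
     (\<forall>c x y. ip (c *\<^sub>C x) y = c *\<^sub>C ip x y) \<and>
     (\<forall>a x y. ip (act a x) y = a * ip x y) \<and>
     (\<forall>x y. cstar (ip x y) = ip y x) \<and>
     (\<forall>x. cstar_pos (ip x x)) \<and>
     (\<forall>x. ip x x = 0 \<longleftrightarrow> x = 0) \<and>
     \<comment> \<open>completeness w.r.t. the norm hm_norm ip\<close>
     (\<forall>X::nat \<Rightarrow> 'x.
        (\<forall>e>0. \<exists>N. \<forall>m\<ge>N. \<forall>n\<ge>N. hm_norm ip (X m - X n) < e) \<longrightarrow>
        (\<exists>l. \<forall>e>0. \<exists>N. \<forall>n\<ge>N. hm_norm ip (X n - l) < e))"

definition hilbert_module_hom ::
  "('a::cstar_algebra \<Rightarrow> 'x::complex_vector \<Rightarrow> 'x) \<Rightarrow> ('x \<Rightarrow> 'x \<Rightarrow> 'a) \<Rightarrow>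
   ('b::cstar_algebra \<Rightarrow> 'y::complex_vector \<Rightarrow> 'y) \<Rightarrow> ('y \<Rightarrow> 'y \<Rightarrow> 'b) \<Rightarrow>
   ('x \<Rightarrow> 'y) \<Rightarrow> bool" where
  "hilbert_module_hom actA ipA actB ipB H \<longleftrightarrow>
     (\<forall>x y. H (x + y) = H x + H y) \<and>
     (\<forall>c x. H (c *\<^sub>C x) = c *\<^sub>C H x) \<and>
     (\<forall>x y z. H (actA (ipA x y) z) = actB (ipB (H x) (H y)) (H z))"

end

theory Submission
  imports Defs
begin

text \<open>
  The homomorphism is \<open>H x = lim 2\<^sup>n f (2\<^sup>-\<^sup>n x)\<close>: the contraction property of \<open>\<phi>\<close> makes this sequence
  Cauchy at a geometric rate, and it turns the approximate identities for \<open>f\<close> into exact ones for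
  \<open>H\<close>. Complex homogeneity follows from additivity and homogeneity under unit scalars, because every
  complex number is an integer multiple of a sum of two unit scalars.

  The estimates need the triangle inequality for \<open>\<parallel>\<langle>x, x\<rangle>\<parallel>\<^sup>1\<^sup>/\<^sup>2\<close>, hence the Cauchy--Schwarz inequality,
  which rests on Kaplansky's theorem that \<open>b\<^sup>*b\<close> is nonnegative in the spectral sense. Nonnegativity
  of a self-adjoint \<open>h\<close> is expressed without spectra by \<open>\<parallel>t - h\<parallel> \<le> t\<close> for some \<open>t \<ge> 0\<close>, and square
  roots are limits of the iteration \<open>w \<mapsto> (x + w\<^sup>2) / 2\<close>.
\<close>

section \<open>Elementary rules for complex scalars and the involution\<close>

lemma scaleC_zero_left [simp]: "0 *\<^sub>C x = (0::'a::complex_vector)"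
  using scaleC_add_left[of 0 0 x] by simp

lemma scaleC_zero_right [simp]: "c *\<^sub>C 0 = (0::'a::complex_vector)"
  using scaleC_add_right[of c 0 0] by simp

lemma scaleC_minus_left: "(- c) *\<^sub>C x = - (c *\<^sub>C (x::'a::complex_vector))"
  using scaleC_add_left[of c "- c" x] by (simp add: eq_neg_iff_add_eq_0 add.commute)

lemma scaleC_minus_right: "c *\<^sub>C (- x) = - (c *\<^sub>C (x::'a::complex_vector))"
  using scaleC_add_right[of c x "- x"] by (simp add: eq_neg_iff_add_eq_0 add.commute)

lemma scaleC_diff_right: "c *\<^sub>C (x - y) = c *\<^sub>C x - c *\<^sub>C (y::'a::complex_vector)"
  using scaleC_add_right[of c x "- y"] by (simp add: scaleC_minus_right)

lemma scaleR_scaleC_commute: "r *\<^sub>R (c *\<^sub>C x) = c *\<^sub>C (r *\<^sub>R (x::'a::complex_vector))"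
  by (simp add: scaleR_scaleC scaleC_scaleC mult.commute)

lemma cstar_zero [simp]: "cstar 0 = (0::'a::cstar_algebra)"
  using cstar_add[of "0::'a" 0] by simp

lemma cstar_minus: "cstar (- a) = - cstar (a::'a::cstar_algebra)"
  using cstar_add[of a "- a"] by (simp add: eq_neg_iff_add_eq_0 add.commute)

lemma cstar_diff: "cstar (a - b) = cstar a - cstar (b::'a::cstar_algebra)"
  using cstar_add[of a "- b"] by (simp add: cstar_minus)

lemma cstar_scaleR: "cstar (r *\<^sub>R a) = r *\<^sub>R cstar (a::'a::cstar_algebra)"
  by (simp add: scaleR_scaleC cstar_scaleC)

text \<open>The C*-identity and submultiplicativity give
  \<open>norm b * norm b \<le> norm (cstar b) * norm b\<close>; cancelling and applying this to both
  \<open>a\<close> and \<open>cstar a\<close> yields equality.\<close>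

lemma norm_cstar [simp]: "norm (cstar a) = norm (a::'a::cstar_algebra)"
proof -
  have le: "norm b \<le> norm (cstar b)" for b :: 'a
  proof (cases "b = 0")
    case False
    have "norm b * norm b \<le> norm (cstar b) * norm b"
      using norm_mult_ineq[of "cstar b" b] by (simp add: cstar_identity power2_eq_square)
    then show ?thesis using False by simp
  qed simp
  show ?thesis using le[of a] le[of "cstar a"] by (simp add: cstar_involutive)
qed

lemma cstar_mult_self_eq_0 [simp]: "cstar a * a = 0 \<longleftrightarrow> a = (0::'a::cstar_algebra)"
  using cstar_identity[of a] by auto

lemma selfadjoint_square_eq_0:
  "\<lbrakk>cstar a = a; a * a = 0\<rbrakk> \<Longrightarrow> a = (0::'a::cstar_algebra)"
  using cstar_mult_self_eq_0[of a] by simp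

lemma bounded_linear_cstar: "bounded_linear (cstar :: 'a::cstar_algebra \<Rightarrow> 'a)"
  by (rule bounded_linear_intro[where K = 1]) (simp_all add: cstar_add cstar_scaleR)

lemma cstar_one [simp]: "cstar 1 = (1::'a::{cstar_algebra,real_normed_algebra_1})"
  by (metis cstar_involutive cstar_mult mult.right_neutral)

section \<open>Square roots\<close>

text \<open>A fixed point w satisfies (1 - w)(1 - w) = 1 - x, so for x = 1 - h the element 1 - w is
  a square root of h.\<close>

primrec sqrt_iter :: "'a::{cstar_algebra,real_normed_algebra_1} \<Rightarrow> nat \<Rightarrow> 'a" where
  "sqrt_iter x 0 = 0"
| "sqrt_iter x (Suc n) = (1/2) *\<^sub>R (x + sqrt_iter x n * sqrt_iter x n)"

text \<open>This is the same iteration for the number x = 1. It controls the iteration in the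
  algebra on the whole closed unit ball, including the boundary, where no geometric rate is
  available.\<close>

primrec sqrt_majorant :: "nat \<Rightarrow> real" where
  "sqrt_majorant 0 = 0"
| "sqrt_majorant (Suc n) = (1 + sqrt_majorant n * sqrt_majorant n) / 2"

lemma sqrt_majorant_bounds: "0 \<le> sqrt_majorant n \<and> sqrt_majorant n \<le> 1"
proof (induction n)
  case (Suc n)
  then have "sqrt_majorant n * sqrt_majorant n \<le> 1"
    by (simp add: mult_le_one)
  then show ?case by simp
qed simp

lemma sqrt_majorant_Suc_le: "sqrt_majorant n \<le> sqrt_majorant (Suc n)"
proof -
  have "0 \<le> (1 - sqrt_majorant n) ^ 2" by simp
  then show ?thesis by (simp add: power2_eq_square algebra_simps)
qed

lemma convergent_sqrt_majorant: "convergent sqrt_majorant"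
proof -
  have "incseq sqrt_majorant"
    using sqrt_majorant_Suc_le by (rule incseq_SucI)
  moreover have "\<forall>n. sqrt_majorant n \<le> 1"
    using sqrt_majorant_bounds by blast
  ultimately show ?thesis
    by (metis incseq_convergent convergent_def)
qed

lemma norm_sqrt_iter_le:
  assumes "norm x \<le> 1"
  shows "norm (sqrt_iter x n) \<le> sqrt_majorant n"
proof (induction n)
  case (Suc n)
  have "norm (sqrt_iter x n * sqrt_iter x n) \<le> sqrt_majorant n * sqrt_majorant n"
    using norm_mult_ineq[of "sqrt_iter x n" "sqrt_iter x n"] Suc
    by (smt (verit) mult_mono norm_ge_zero)
  then show ?case
    using assms norm_triangle_ineq[of x "sqrt_iter x n * sqrt_iter x n"] by simp
qed simp

text \<open>The factorization used here keeps the order of the factors, so it holds without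
  commutativity.\<close>

lemma norm_square_diff_le:
  fixes a b :: "'a::real_normed_algebra"
  shows "norm (a * a - b * b) \<le> norm a * norm (a - b) + norm (a - b) * norm b"
proof -
  have "a * a - b * b = a * (a - b) + (a - b) * b"
    by (simp add: algebra_simps)
  then show ?thesis
    using norm_triangle_mono[OF norm_mult_ineq norm_mult_ineq] by metis
qed

text \<open>Each increment is half a difference of squares. Bounding its factors by the scalar
  iteration reproduces the corresponding difference of squares there, so the induction
  closes.\<close>

lemma norm_sqrt_iter_Suc_diff_le:
  assumes "norm x \<le> 1"
  shows "norm (sqrt_iter x (Suc n) - sqrt_iter x n) \<le> sqrt_majorant (Suc n) - sqrt_majorant n"
proof (induction n)
  case 0
  then show ?case using assms by simp
next
  case (Suc n)
  let ?a = "sqrt_iter x (Suc n)" and ?b = "sqrt_iter x n"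
  let ?s = "sqrt_majorant (Suc n)" and ?t = "sqrt_majorant n"
  have "norm (?a * ?a - ?b * ?b) \<le> norm ?a * norm (?a - ?b) + norm (?a - ?b) * norm ?b"
    by (rule norm_square_diff_le)
  also have "\<dots> \<le> ?s * (?s - ?t) + (?s - ?t) * ?t"
    by (intro add_mono mult_mono norm_sqrt_iter_le assms Suc norm_ge_zero)
       (use sqrt_majorant_bounds sqrt_majorant_Suc_le[of n] in \<open>simp_all del: sqrt_majorant.simps\<close>)
  also have "\<dots> = ?s * ?s - ?t * ?t"
    by (simp only: algebra_simps)
  finally have *: "norm (?a * ?a - ?b * ?b) \<le> ?s * ?s - ?t * ?t" .
  have "sqrt_iter x (Suc (Suc n)) - ?a = (1/2) *\<^sub>R (?a * ?a - ?b * ?b)"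
    using add_diff_cancel_left[of x "?a * ?a" "?b * ?b"]
      scaleR_diff_right[of "1/2" "x + ?a * ?a" "x + ?b * ?b"]
    by (metis sqrt_iter.simps(2))
  then have "norm (sqrt_iter x (Suc (Suc n)) - ?a) = norm (?a * ?a - ?b * ?b) / 2"
    by simp
  also have "\<dots> \<le> (?s * ?s - ?t * ?t) / 2"
    using * by simp
  also have "\<dots> = sqrt_majorant (Suc (Suc n)) - ?s"
    using sqrt_majorant.simps(2)[of n] sqrt_majorant.simps(2)[of "Suc n"] by argo
  finally show ?case .
qed

lemma norm_sqrt_iter_diff_le:
  assumes "norm x \<le> 1" "m \<le> n"
  shows "norm (sqrt_iter x n - sqrt_iter x m) \<le> sqrt_majorant n - sqrt_majorant m"
  using assms(2)
proof (induction n rule: dec_induct)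
  case (step n)
  have "norm (sqrt_iter x (Suc n) - sqrt_iter x m)
      \<le> norm (sqrt_iter x (Suc n) - sqrt_iter x n) + norm (sqrt_iter x n - sqrt_iter x m)"
    using norm_triangle_ineq[of "sqrt_iter x (Suc n) - sqrt_iter x n" "sqrt_iter x n - sqrt_iter x m"]
    by (simp del: sqrt_iter.simps)
  then show ?case
    using norm_sqrt_iter_Suc_diff_le[OF assms(1), of n] step.IH by linarith
qed simp

text \<open>Distances between iterates are dominated by those of the scalar iteration, which is
  monotone and bounded, hence Cauchy.\<close>

lemma convergent_sqrt_iter:
  assumes "norm x \<le> 1"
  shows "convergent (sqrt_iter x)"
proof (rule Cauchy_convergent, rule metric_CauchyI)
  fix e :: real assume "0 < e"
  moreover have "Cauchy sqrt_majorant"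
    using convergent_sqrt_majorant by (rule convergent_Cauchy)
  ultimately obtain M where M: "dist (sqrt_majorant m) (sqrt_majorant n) < e" if "m \<ge> M" "n \<ge> M" for m n
    by (meson metric_CauchyD)
  have le: "dist (sqrt_iter x m) (sqrt_iter x n) \<le> dist (sqrt_majorant m) (sqrt_majorant n)" for m n
  proof (cases "m \<le> n")
    case True
    then show ?thesis
      using norm_sqrt_iter_diff_le[OF assms True] by (simp add: dist_norm norm_minus_commute)
  next
    case False
    then show ?thesis
      using norm_sqrt_iter_diff_le[OF assms, of n m] by (simp add: dist_norm)
  qed
  show "\<exists>M. \<forall>m\<ge>M. \<forall>n\<ge>M. dist (sqrt_iter x m) (sqrt_iter x n) < e"
    using M le by (meson order_le_less_trans)
qed

text \<open>Used only under \<open>norm (1 - h) \<le> 1\<close>, which guarantees that the iteration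
  converges and \<open>lim\<close> is its limit.\<close>

definition cstar_sqrt :: "'a::{cstar_algebra,real_normed_algebra_1} \<Rightarrow> 'a" where
  "cstar_sqrt h = 1 - lim (sqrt_iter (1 - h))"

lemma sqrt_iter_tendsto:
  assumes "norm (1 - h) \<le> 1"
  shows "sqrt_iter (1 - h) \<longlonglongrightarrow> 1 - cstar_sqrt h"
  using convergent_sqrt_iter[OF assms] by (simp add: cstar_sqrt_def convergent_LIMSEQ_iff)

lemma norm_one_minus_cstar_sqrt:
  assumes "norm (1 - h) \<le> 1"
  shows "norm (1 - cstar_sqrt h) \<le> 1"
proof (rule LIMSEQ_le_const2[OF tendsto_norm[OF sqrt_iter_tendsto[OF assms]]])
  show "\<exists>N. \<forall>n\<ge>N. norm (sqrt_iter (1 - h) n) \<le> 1"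
    using norm_sqrt_iter_le[OF assms] sqrt_majorant_bounds order_trans by blast
qed

lemma cstar_sqrt_square:
  assumes "norm (1 - h) \<le> 1"
  shows "cstar_sqrt h * cstar_sqrt h = h"
proof -
  define w where "w = 1 - cstar_sqrt h"
  have lim: "sqrt_iter (1 - h) \<longlonglongrightarrow> w"
    unfolding w_def by (rule sqrt_iter_tendsto[OF assms])
  have "(\<lambda>n. sqrt_iter (1 - h) (Suc n)) \<longlonglongrightarrow> (1/2) *\<^sub>R ((1 - h) + w * w)"
    unfolding sqrt_iter.simps by (intro tendsto_intros lim)
  moreover have "(\<lambda>n. sqrt_iter (1 - h) (Suc n)) \<longlonglongrightarrow> w"
    using lim by (rule LIMSEQ_Suc)
  ultimately have "(1/2) *\<^sub>R ((1 - h) + w * w) = w"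
    by (rule LIMSEQ_unique)
  then have "2 *\<^sub>R w = (1 - h) + w * w"
    by (metis scaleR_half_double scaleR_2 scaleR_right_distrib)
  then have "w + w = 1 - h + w * w"
    by (simp add: scaleR_2)
  then have "(1 - w) * (1 - w) = h"
    by (simp add: algebra_simps)
  then show ?thesis
    by (simp add: w_def)
qed

lemma cstar_sqrt_selfadjoint:
  assumes "norm (1 - h) \<le> 1" "cstar h = h"
  shows "cstar (cstar_sqrt h) = cstar_sqrt h"
proof -
  have "cstar (sqrt_iter (1 - h) n) = sqrt_iter (1 - h) n" for n
    by (induction n) (simp_all add: cstar_scaleR cstar_add cstar_mult cstar_diff assms(2))
  then have "(\<lambda>n. sqrt_iter (1 - h) n) \<longlonglongrightarrow> cstar (1 - cstar_sqrt h)"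
    using bounded_linear.tendsto[OF bounded_linear_cstar sqrt_iter_tendsto[OF assms(1)]] by simp
  then have "cstar (1 - cstar_sqrt h) = 1 - cstar_sqrt h"
    using sqrt_iter_tendsto[OF assms(1)] LIMSEQ_unique by blast
  then show ?thesis
    by (simp add: cstar_diff)
qed

text \<open>The relation passes to each iterate by induction and then to the limit. For h = k it
  says that the root commutes with everything that commutes with h.\<close>

lemma cstar_sqrt_intertwine:
  assumes "norm (1 - h) \<le> 1" "norm (1 - k) \<le> 1" "c * h = k * c"
  shows "c * cstar_sqrt h = cstar_sqrt k * c"
proof -
  have "c * sqrt_iter (1 - h) n = sqrt_iter (1 - k) n * c" for n
  proof (induction n)
    case (Suc n)
    have "c * (sqrt_iter (1 - h) n * sqrt_iter (1 - h) n)
        = (sqrt_iter (1 - k) n * sqrt_iter (1 - k) n) * c"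
      by (metis Suc mult.assoc)
    then show ?case
      by (simp add: algebra_simps assms(3))
  qed simp
  moreover have "(\<lambda>n. c * sqrt_iter (1 - h) n) \<longlonglongrightarrow> c * (1 - cstar_sqrt h)"
    by (intro tendsto_intros sqrt_iter_tendsto assms)
  moreover have "(\<lambda>n. sqrt_iter (1 - k) n * c) \<longlonglongrightarrow> (1 - cstar_sqrt k) * c"
    by (intro tendsto_intros sqrt_iter_tendsto assms)
  ultimately have "c * (1 - cstar_sqrt h) = (1 - cstar_sqrt k) * c"
    using LIMSEQ_unique by fastforce
  then show ?thesis
    by (simp add: algebra_simps)
qed

text \<open>Commutativity gives \<open>cstar u * u = x * x + y * y\<close> for u = x + iy, so the
  C*-identity computes the norm of u; x is the real part of u and has no larger norm.\<close>

lemma norm_le_of_commuting_squares: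
  fixes x y :: "'a::{cstar_algebra,real_normed_algebra_1}"
  assumes "cstar x = x" "cstar y = y" "x * y = y * x" "x * x + y * y = s *\<^sub>R 1" "0 \<le> s"
  shows "(norm x)\<^sup>2 \<le> s"
proof -
  define u where "u = x + \<i> *\<^sub>C y"
  have cu: "cstar u = x - \<i> *\<^sub>C y"
    by (simp add: u_def cstar_add cstar_scaleC assms scaleC_minus_left)
  have "cstar u * u = x * x + y * y"
    unfolding cu unfolding u_def
    by (simp add: distrib_left left_diff_distrib mult_scaleC_left mult_scaleC_right
        scaleC_scaleC scaleC_diff_right scaleC_minus_left scaleC_one assms(3))
  then have nu: "(norm u)\<^sup>2 = s"
    using cstar_identity[of u] assms(4,5) by simp
  have "2 *\<^sub>R x = u + cstar u"
    unfolding cu unfolding u_def by (simp add: scaleR_2)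
  then have "2 * norm x \<le> 2 * norm u"
    using norm_triangle_ineq[of u "cstar u"] by (metis norm_cstar norm_scaleR abs_numeral mult_2)
  then show ?thesis
    using nu by (metis mult_le_cancel_left_pos norm_ge_zero power_mono zero_less_numeral)
qed

text \<open>The root w of 1 - k^2 commutes with k and w^2 + k^2 = 1, so the preceding bound applies
  to w.\<close>

lemma norm_one_minus_square:
  fixes k :: "'a::{cstar_algebra,real_normed_algebra_1}"
  assumes "cstar k = k" "norm k \<le> 1"
  shows "norm (1 - k * k) \<le> 1"
proof -
  define w where "w = cstar_sqrt (1 - k * k)"
  have kk: "norm (k * k) \<le> 1"
    using norm_mult_ineq[of k k] assms(2) by (simp add: mult_le_one order_trans)
  then have n: "norm (1 - (1 - k * k)) \<le> 1" by simp
  have ww: "w * w = 1 - k * k"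
    unfolding w_def by (rule cstar_sqrt_square[OF n])
  have sa: "cstar w = w"
    unfolding w_def by (rule cstar_sqrt_selfadjoint[OF n]) (simp add: cstar_diff cstar_mult assms)
  have "k * w = w * k"
    unfolding w_def by (rule cstar_sqrt_intertwine[OF n n]) (simp add: algebra_simps)
  then have "(norm w)\<^sup>2 \<le> 1"
    by (intro norm_le_of_commuting_squares[of w k 1]) (simp_all add: ww sa assms)
  then show ?thesis
    using cstar_identity[of w] by (simp add: sa ww)
qed

section \<open>Nonnegative elements\<close>

text \<open>For self-adjoint h the norm bound places the spectrum in [0, 2t]. In this form closure
  under addition is just the triangle inequality.\<close>

definition cstar_nonneg :: "'a::{cstar_algebra,real_normed_algebra_1} \<Rightarrow> bool" where
  "cstar_nonneg h \<longleftrightarrow> cstar h = h \<and> (\<exists>t\<ge>0. norm (t *\<^sub>R 1 - h) \<le> t)"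

lemma cstar_nonneg_add:
  assumes "cstar_nonneg h" "cstar_nonneg k"
  shows "cstar_nonneg (h + k)"
proof -
  obtain s t where st: "0 \<le> s" "norm (s *\<^sub>R 1 - h) \<le> s" "0 \<le> t" "norm (t *\<^sub>R 1 - k) \<le> t"
    using assms by (auto simp: cstar_nonneg_def)
  have eq: "(s + t) *\<^sub>R 1 - (h + k) = (s *\<^sub>R 1 - h) + (t *\<^sub>R 1 - k)"
    by (simp add: algebra_simps)
  have "norm ((s + t) *\<^sub>R 1 - (h + k)) \<le> s + t"
    unfolding eq using st by (intro norm_triangle_mono)
  then show ?thesis
    using assms st by (auto simp: cstar_nonneg_def cstar_add intro!: exI[of _ "s + t"])
qed

lemma cstar_nonneg_scaleR:
  assumes "cstar_nonneg h" "0 \<le> r"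
  shows "cstar_nonneg (r *\<^sub>R h)"
proof -
  obtain t where t: "0 \<le> t" "norm (t *\<^sub>R 1 - h) \<le> t"
    using assms by (auto simp: cstar_nonneg_def)
  have "norm ((r * t) *\<^sub>R 1 - r *\<^sub>R h) = r * norm (t *\<^sub>R 1 - h)"
    using assms(2) by (metis abs_of_nonneg norm_scaleR scaleR_diff_right scaleR_scaleR)
  also have "\<dots> \<le> r * t"
    using t assms(2) by (simp add: mult_left_mono)
  finally show ?thesis
    using assms t by (auto simp: cstar_nonneg_def cstar_scaleR intro!: exI[of _ "r * t"])
qed

lemma cstar_nonneg_unit_ball:
  assumes "cstar h = h" "norm (1 - h) \<le> 1"
  shows "cstar_nonneg h"
  using assms unfolding cstar_nonneg_def by (auto intro!: exI[of _ 1])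

lemma cstar_nonneg_norm_minus:
  assumes "cstar h = h" "norm h \<le> s"
  shows "cstar_nonneg (s *\<^sub>R 1 - h)"
  using assms order_trans[OF norm_ge_zero assms(2)]
  by (auto simp: cstar_nonneg_def cstar_diff cstar_scaleR intro!: exI[of _ s])

lemma cstar_nonneg_square:
  fixes k :: "'a::{cstar_algebra,real_normed_algebra_1}"
  assumes "cstar k = k"
  shows "cstar_nonneg (k * k)"
proof -
  \<comment> \<open>The summand 1 keeps the scaling factor positive when k = 0.\<close>
  define r where "r = norm k + 1"
  have r: "0 < r" by (simp add: r_def add_nonneg_pos)
  define l where "l = (1/r) *\<^sub>R k"
  have l: "cstar l = l" by (simp add: l_def cstar_scaleR assms)
  have "norm l \<le> 1" using r by (simp add: l_def r_def)
  then have "cstar_nonneg (l * l)"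
    by (intro cstar_nonneg_unit_ball norm_one_minus_square) (simp_all add: cstar_mult l)
  then have "cstar_nonneg ((r * r) *\<^sub>R (l * l))"
    using r by (intro cstar_nonneg_scaleR) simp_all
  moreover have "(r * r) *\<^sub>R (l * l) = k * k"
    using r by (simp add: l_def)
  ultimately show ?thesis by simp
qed

text \<open>Scaling by 1/t moves h into the ball around 1 where the iteration converges. The
  commutation property is recorded because later arguments multiply roots of different
  elements.\<close>

lemma cstar_nonneg_sqrt:
  fixes h :: "'a::{cstar_algebra,real_normed_algebra_1}"
  assumes "cstar_nonneg h"
  obtains k where "cstar k = k" "k * k = h" "\<And>c. c * h = h * c \<Longrightarrow> c * k = k * c"
proof -
  obtain t0 where t0: "0 \<le> t0" "norm (t0 *\<^sub>R 1 - h) \<le> t0"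
    using assms by (auto simp: cstar_nonneg_def)
  \<comment> \<open>The witness \<open>t0\<close> may be 0; enlarging it by 1 preserves the norm
    bound and permits division.\<close>
  define t where "t = t0 + 1"
  have t: "0 < t" using t0 by (simp add: t_def)
  have eq: "t *\<^sub>R 1 - h = 1 + (t0 *\<^sub>R 1 - h)"
    by (simp add: t_def algebra_simps)
  have nt: "norm (t *\<^sub>R 1 - h) \<le> t"
    unfolding eq using norm_triangle_ineq[of 1 "t0 *\<^sub>R 1 - h"] t0 by (simp add: t_def)
  define g where "g = (1/t) *\<^sub>R h"
  have "1 - g = (1/t) *\<^sub>R (t *\<^sub>R 1 - h)"
    using t by (simp add: g_def algebra_simps)
  then have n: "norm (1 - g) \<le> 1"
    using nt t by simp
  have sag: "cstar g = g"
    using assms by (simp add: g_def cstar_scaleR cstar_nonneg_def)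
  show thesis
  proof (rule that[of "sqrt t *\<^sub>R cstar_sqrt g"])
    show "cstar (sqrt t *\<^sub>R cstar_sqrt g) = sqrt t *\<^sub>R cstar_sqrt g"
      by (simp add: cstar_scaleR cstar_sqrt_selfadjoint[OF n sag])
    show "sqrt t *\<^sub>R cstar_sqrt g * sqrt t *\<^sub>R cstar_sqrt g = h"
      using t by (simp add: cstar_sqrt_square[OF n]) (simp add: g_def)
    fix c assume "c * h = h * c"
    then have "c * g = g * c" by (simp add: g_def)
    then show "c * sqrt t *\<^sub>R cstar_sqrt g = sqrt t *\<^sub>R cstar_sqrt g * c"
      using cstar_sqrt_intertwine[OF n n] by simp
  qed
qed

text \<open>The roots x of h and y of s - h commute and their squares add up to s, so (norm x)^2,
  which is norm h, is at most s.\<close>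

lemma cstar_nonneg_norm_le:
  fixes h :: "'a::{cstar_algebra,real_normed_algebra_1}"
  assumes "cstar_nonneg h" "cstar_nonneg (s *\<^sub>R 1 - h)" "0 \<le> s"
  shows "norm h \<le> s"
proof -
  obtain x where x: "cstar x = x" "x * x = h" "\<And>c. c * h = h * c \<Longrightarrow> c * x = x * c"
    using cstar_nonneg_sqrt[OF assms(1)] by blast
  obtain y where y: "cstar y = y" "y * y = s *\<^sub>R 1 - h"
    using cstar_nonneg_sqrt[OF assms(2)] by blast
  have h: "h = s *\<^sub>R 1 - y * y"
    using y by simp
  \<comment> \<open>y commutes with its own square, hence with h, hence with the root x of
    h.\<close>
  have "y * h = h * y"
    unfolding h by (simp add: algebra_simps)
  then have "x * y = y * x"
    using x(3) by simp
  then have "(norm x)\<^sup>2 \<le> s"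
    using x(1,2) y assms(3) by (intro norm_le_of_commuting_squares[of x y s]) simp_all
  then show ?thesis
    using cstar_identity[of x] x(1,2) by simp
qed

lemma cstar_nonneg_antisym:
  assumes "cstar_nonneg h" "cstar_nonneg (- h)"
  shows "h = 0"
  using cstar_nonneg_norm_le[of h 0] assms by simp

text \<open>With r = p - q, commutativity gives (p + q) r = 0. Writing p = x^2 and q = y^2, this
  makes the squares of xr and yr add up to 0, so both vanish; then pr = qr = 0 and r^2 = 0.\<close>

lemma cstar_nonneg_sqrt_unique:
  fixes p q :: "'a::{cstar_algebra,real_normed_algebra_1}"
  assumes "cstar_nonneg p" "cstar_nonneg q" "p * q = q * p" "p * p = q * q"
  shows "p = q"
proof -
  define r where "r = p - q"
  have sa: "cstar r = r"
    using assms(1,2) by (simp add: r_def cstar_diff cstar_nonneg_def)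
  obtain x where x: "cstar x = x" "x * x = p" "\<And>c. c * p = p * c \<Longrightarrow> c * x = x * c"
    using cstar_nonneg_sqrt[OF assms(1)] by blast
  obtain y where y: "cstar y = y" "y * y = q" "\<And>c. c * q = q * c \<Longrightarrow> c * y = y * c"
    using cstar_nonneg_sqrt[OF assms(2)] by blast
  have "r * p = p * r" "r * q = q * r"
    using assms(3) by (simp_all add: r_def algebra_simps)
  then have comm: "r * x = x * r" "r * y = y * r"
    using x(3) y(3) by blast+
  \<comment> \<open>Commutation makes these products self-adjoint, so their squares are
    nonnegative.\<close>
  have sax: "cstar (x * r) = x * r" and say: "cstar (y * r) = y * r"
    using comm by (simp_all add: cstar_mult sa x(1) y(1))
  have xr: "(x * r) * (x * r) = p * (r * r)"
    by (metis comm(1) mult.assoc x(2))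
  have yr: "(y * r) * (y * r) = q * (r * r)"
    by (metis comm(2) mult.assoc y(2))
  have "(p + q) * r = 0"
    using assms(3,4) by (simp add: r_def algebra_simps)
  then have "p * (r * r) + q * (r * r) = 0"
    by (metis distrib_right mult.assoc mult_zero_left)
  then have eq: "(y * r) * (y * r) = - ((x * r) * (x * r))"
    unfolding xr yr by (simp add: eq_neg_iff_add_eq_0 add.commute)
  have "(x * r) * (x * r) = 0"
    using cstar_nonneg_square[OF sax] cstar_nonneg_square[OF say] unfolding eq
    by (rule cstar_nonneg_antisym)
  then have "x * r = 0" "y * r = 0"
    using eq selfadjoint_square_eq_0 sax say by auto
  then have "p * r = 0" "q * r = 0"
    by (metis mult.assoc mult_zero_right x(2), metis \<open>y * r = 0\<close> mult.assoc mult_zero_right y(2))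
  then have "r * r = 0"
    by (simp add: r_def left_diff_distrib)
  then show ?thesis
    using selfadjoint_square_eq_0[OF sa] by (simp add: r_def)
qed

section \<open>Kaplansky's theorem\<close>

lemma norm_square_le_one: "norm a \<le> 1 \<Longrightarrow> norm (a * a) \<le> (1::real)"
  for a :: "'a::real_normed_algebra"
  using norm_mult_ineq[of a a] mult_le_one[of "norm a" "norm a"] by simp

lemma norm_le_one_of_square:
  fixes a :: "'a::cstar_algebra"
  assumes "cstar a = a" "norm (a * a) \<le> 1"
  shows "norm a \<le> 1"
  using cstar_identity[of a] assms by (simp add: abs_square_le_1)

text \<open>
  The nonzero spectra of \<open>c\<^sup>*c\<close> and \<open>cc\<^sup>*\<close> agree; the intertwining relation
  \<open>c |c\<^sup>*c| = |cc\<^sup>*| c\<close> replaces this spectral argument.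
\<close>

lemma cstar_nonneg_minus_mult_cstar:
  fixes c d :: "'a::{cstar_algebra,real_normed_algebra_1}"
  assumes "cstar c * c = - (d * d)" "cstar d = d" "norm c \<le> 1"
  shows "cstar_nonneg (- (c * cstar c))"
proof -
  define e where "e = cstar c * c"
  define g where "g = c * cstar c"
  have sae: "cstar e = e" and sag: "cstar g = g"
    by (simp_all add: e_def g_def cstar_mult cstar_involutive)
  have ne: "norm e \<le> 1" and ng: "norm g \<le> 1"
    using cstar_identity[of c] cstar_identity[of "cstar c"] assms(3)
    by (simp_all add: e_def g_def cstar_involutive abs_square_le_1)
  \<comment> \<open>\<open>a\<close> and \<open>b\<close> are the absolute values of
    \<open>e\<close> and \<open>g\<close>.\<close>
  define a where "a = cstar_sqrt (e * e)"
  define b where "b = cstar_sqrt (g * g)"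
  note n = norm_one_minus_square[OF sae ne] norm_one_minus_square[OF sag ng]
  have a: "a * a = e * e" "cstar a = a" "norm (1 - a) \<le> 1" "e * a = a * e"
    unfolding a_def using n(1)
    by (auto intro!: cstar_sqrt_square cstar_sqrt_selfadjoint norm_one_minus_cstar_sqrt
        cstar_sqrt_intertwine simp: cstar_mult sae mult.assoc)
  have b: "b * b = g * g" "cstar b = b" "norm (1 - b) \<le> 1"
    unfolding b_def using n(2)
    by (auto intro!: cstar_sqrt_square cstar_sqrt_selfadjoint norm_one_minus_cstar_sqrt
        simp: cstar_mult sag)
  have cab: "c * a = b * c"
    unfolding a_def b_def
    by (rule cstar_sqrt_intertwine[OF n]) (simp add: e_def g_def mult.assoc)
  have dd: "d * d = - e"
    using assms(1) by (simp add: e_def)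
  \<comment> \<open>Both sides are nonnegative commuting roots of e^2, because d^2 = -e.\<close>
  have "a = d * d"
  proof (rule cstar_nonneg_sqrt_unique)
    show "a * (d * d) = d * d * a" "a * a = d * d * (d * d)"
      using a(1,4) by (simp_all add: dd)
  qed (simp_all add: a(2,3) cstar_nonneg_unit_ball cstar_nonneg_square assms(2))
  then have "b * c = - (g * c)"
    using cab dd by (simp add: e_def g_def mult.assoc)
  \<comment> \<open>Multiply the preceding relation on the right by \<open>cstar c\<close>.\<close>
  then have bg: "b * g = - (g * g)"
    unfolding g_def by (metis mult.assoc minus_mult_left)
  then have gb: "g * b = - (g * g)"
    by (metis b(2) cstar_minus cstar_mult sag)
  have "(b + g) * (b + g) = 0"
    by (simp add: distrib_left distrib_right b(1) bg gb)
  then have "b + g = 0"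
    using selfadjoint_square_eq_0[of "b + g"] by (simp add: cstar_add b(2) sag)
  then have "- g = b"
    by (simp add: eq_neg_iff_add_eq_0 neg_eq_iff_add_eq_0 add.commute)
  then show ?thesis
    using cstar_nonneg_unit_ball[OF b(2,3)] by (simp add: g_def)
qed

text \<open>The self-adjoint elements p and q are, up to sign, twice the real and imaginary parts of
  c, and p^2 + q^2 is twice the sum of \<open>c * cstar c\<close> and \<open>cstar c * c\<close>.
  Both of these are nonpositive, which forces p^2 = q^2 = 0.\<close>

lemma cstar_mult_self_eq_neg_square:
  fixes c d :: "'a::{cstar_algebra,real_normed_algebra_1}"
  assumes "cstar c * c = - (d * d)" "cstar d = d" "norm c \<le> 1"
  shows "c = 0"
proof -
  define p where "p = c + cstar c"
  define q where "q = \<i> *\<^sub>C (c - cstar c)"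
  have sap: "cstar p = p"
    by (simp add: p_def cstar_add cstar_involutive add.commute)
  have saq: "cstar q = q"
    by (simp add: q_def cstar_scaleC cstar_diff cstar_involutive scaleC_minus_left
        flip: scaleC_minus_right)
  have qq: "q * q = - ((c - cstar c) * (c - cstar c))"
    by (simp add: q_def mult_scaleC_left mult_scaleC_right scaleC_scaleC scaleC_minus_left scaleC_one)
  have sum: "p * p + q * q = 2 *\<^sub>R (c * cstar c + cstar c * c)"
    unfolding qq p_def by (simp add: algebra_simps scaleR_2)
  have "cstar_nonneg (2 *\<^sub>R (- (c * cstar c) + - (cstar c * c)))"
    by (intro cstar_nonneg_scaleR cstar_nonneg_add cstar_nonneg_minus_mult_cstar[OF assms])
       (simp_all add: assms(1) cstar_nonneg_square[OF assms(2)])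
  then have neg: "cstar_nonneg (- (p * p + q * q))"
    unfolding sum by (simp add: algebra_simps)
  have "cstar_nonneg (- (p * p + q * q) + q * q)" "cstar_nonneg (- (p * p + q * q) + p * p)"
    using cstar_nonneg_add neg cstar_nonneg_square sap saq by blast+
  then have "cstar_nonneg (- (p * p))" "cstar_nonneg (- (q * q))"
    by simp_all
  then have "p * p = 0" "q * q = 0"
    using cstar_nonneg_antisym cstar_nonneg_square sap saq by blast+
  then have "p = 0" "q = 0"
    using selfadjoint_square_eq_0 sap saq by blast+
  have "c - cstar c = - (\<i> *\<^sub>C q)"
    by (simp add: q_def scaleC_scaleC scaleC_minus_left scaleC_one)
  then have "c - cstar c = 0"
    using \<open>q = 0\<close> by simp
  moreover have "c + cstar c = 0"
    using \<open>p = 0\<close> by (simp add: p_def)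
  ultimately have "2 *\<^sub>R c = 0"
    by (simp add: scaleR_2)
  then show ?thesis by simp
qed

text \<open>
  Kaplansky's argument: if \<open>k\<close> is the negative part of \<open>h = b\<^sup>*b\<close>, then \<open>c = bk\<close> satisfies
  \<open>c\<^sup>*c = khk = -|h|k\<^sup>2\<close>, minus a square.
\<close>

lemma cstar_nonneg_cstar_mult_self_unit:
  fixes b :: "'a::{cstar_algebra,real_normed_algebra_1}"
  assumes "norm b \<le> 1"
  shows "cstar_nonneg (cstar b * b)"
proof -
  define h where "h = cstar b * b"
  have sah: "cstar h = h"
    by (simp add: h_def cstar_mult cstar_involutive)
  have nh: "norm h \<le> 1"
    using assms by (simp add: h_def cstar_identity abs_square_le_1)
  note n = norm_one_minus_square[OF sah nh]
  define a where "a = cstar_sqrt (h * h)"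
  have a: "a * a = h * h" "cstar a = a" "norm (1 - a) \<le> 1" "h * a = a * h"
    unfolding a_def using n
    by (auto intro!: cstar_sqrt_square cstar_sqrt_selfadjoint norm_one_minus_cstar_sqrt
        cstar_sqrt_intertwine simp: cstar_mult sah mult.assoc)
  have na: "norm a \<le> 1"
    using norm_le_one_of_square[OF a(2)] norm_square_le_one[OF nh] a(1) by simp
  \<comment> \<open>\<open>a\<close> is the absolute value of h, and its root \<open>m\<close>
    commutes with h; it serves to write \<open>a * k * k\<close> as the square of the self-adjoint
    element \<open>m * k\<close>.\<close>
  define m where "m = cstar_sqrt a"
  have m: "m * m = a" "cstar m = m" "h * m = m * h" "a * m = m * a"
    unfolding m_def using a(3)
    by (auto intro!: cstar_sqrt_square cstar_sqrt_selfadjoint cstar_sqrt_intertwine simp: a(2,4))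
  define k where "k = (1/2) *\<^sub>R (a - h)"
  have sak: "cstar k = k"
    by (simp add: k_def cstar_scaleR cstar_diff a(2) sah)
  have nk: "norm k \<le> 1"
    using norm_triangle_ineq4[of a h] na nh by (simp add: k_def)
  have km: "k * m = m * k"
    by (simp add: k_def algebra_simps m(3,4))
  \<comment> \<open>Both identities come from a^2 = h^2: twice k h is ah - h^2, and twice a k is h^2
    - ah.\<close>
  have kh: "k * h = - (a * k)" and hk: "h * k = - (a * k)"
    by (simp_all add: k_def algebra_simps a(1,4))
  define d where "d = m * k"
  have sad: "cstar d = d"
    by (simp add: d_def cstar_mult m(2) sak km)
  have dd: "d * d = a * k * k"
    unfolding d_def by (metis km m(1) mult.assoc)
  have "cstar (b * k) * (b * k) = k * h * k"
    by (simp add: cstar_mult sak h_def mult.assoc)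
  also have "\<dots> = - (d * d)"
    by (simp add: kh dd)
  finally have cc: "cstar (b * k) * (b * k) = - (d * d)" .
  have "norm (b * k) \<le> 1"
    using norm_mult_ineq[of b k] mult_le_one[of "norm b" "norm k"] assms nk by simp
  then have "b * k = 0"
    by (rule cstar_mult_self_eq_neg_square[OF cc sad])
  then have "h * k = 0"
    by (simp add: h_def mult.assoc)
  moreover have "a * k = 0"
    using \<open>h * k = 0\<close> hk by simp
  \<comment> \<open>k is half of a - h, and both a and h annihilate k.\<close>
  ultimately have "k * k = 0"
    by (subst k_def) (simp add: left_diff_distrib)
  then have "k = 0"
    by (rule selfadjoint_square_eq_0[OF sak])
  then have "h = a"
    by (simp add: k_def)
  then show ?thesis
    using cstar_nonneg_unit_ball[OF a(2,3)] by (simp add: h_def)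
qed

theorem cstar_nonneg_cstar_mult_self:
  fixes b :: "'a::{cstar_algebra,real_normed_algebra_1}"
  shows "cstar_nonneg (cstar b * b)"
proof -
  define r where "r = norm b + 1"
  have r: "0 < r" by (simp add: r_def add_nonneg_pos)
  define l where "l = (1/r) *\<^sub>R b"
  have "norm l \<le> 1" using r by (simp add: l_def r_def)
  then have "cstar_nonneg ((r * r) *\<^sub>R (cstar l * l))"
    using r by (intro cstar_nonneg_scaleR cstar_nonneg_cstar_mult_self_unit) simp_all
  moreover have "(r * r) *\<^sub>R (cstar l * l) = cstar b * b"
    using r by (simp add: l_def cstar_scaleR)
  ultimately show ?thesis by simp
qed

section \<open>Conjugation and monotonicity of the norm\<close>

lemma cstar_nonneg_conjugate:
  fixes h a :: "'a::{cstar_algebra,real_normed_algebra_1}"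
  assumes "cstar_nonneg h"
  shows "cstar_nonneg (cstar a * h * a)"
proof -
  obtain k where "cstar k = k" "k * k = h"
    using cstar_nonneg_sqrt[OF assms] by blast
  then have "cstar a * h * a = cstar (k * a) * (k * a)"
    by (simp add: cstar_mult mult.assoc flip: \<open>k * k = h\<close>)
  then show ?thesis
    by (simp add: cstar_nonneg_cstar_mult_self)
qed

text \<open>The element norm k - h is the sum of the nonnegative elements norm k - k and k - h, so
  the norm bound for nonnegative elements applies.\<close>

lemma cstar_norm_mono:
  fixes h k :: "'a::{cstar_algebra,real_normed_algebra_1}"
  assumes "cstar_nonneg h" "cstar_nonneg (k - h)"
  shows "norm h \<le> norm k"
proof -
  have "cstar k = cstar ((k - h) + h)" by simp
  also have "\<dots> = k"
    unfolding cstar_add using assms by (simp add: cstar_nonneg_def)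
  finally have "cstar_nonneg (norm k *\<^sub>R 1 - k)"
    by (rule cstar_nonneg_norm_minus) simp
  then have "cstar_nonneg ((norm k *\<^sub>R 1 - k) + (k - h))"
    using assms(2) by (rule cstar_nonneg_add)
  then show ?thesis
    using assms(1) by (intro cstar_nonneg_norm_le) simp_all
qed

section \<open>Unitization\<close>

text \<open>A pair stands for the formal sum of a scalar multiple of a new unit and an element of
  the algebra. It makes the unital results above available in an arbitrary C*-algebra.\<close>

datatype 'a unitization = Unitization (scalar_part: complex) (algebra_part: 'a)

lemma unitization_eq_iff:
  "u = v \<longleftrightarrow> scalar_part u = scalar_part v \<and> algebra_part u = algebra_part v"
  by (cases u; cases v) auto

instantiation unitization :: (cstar_algebra) "{ring_1, complex_vector}"
begin

definition zero_unitization :: "'a unitization" where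
  "0 = Unitization 0 0"
definition one_unitization :: "'a unitization" where
  "1 = Unitization 1 0"
definition plus_unitization :: "'a unitization \<Rightarrow> 'a unitization \<Rightarrow> 'a unitization" where
  "u + v = Unitization (scalar_part u + scalar_part v) (algebra_part u + algebra_part v)"
definition minus_unitization :: "'a unitization \<Rightarrow> 'a unitization \<Rightarrow> 'a unitization" where
  "u - v = Unitization (scalar_part u - scalar_part v) (algebra_part u - algebra_part v)"
definition uminus_unitization :: "'a unitization \<Rightarrow> 'a unitization" where
  "- u = Unitization (- scalar_part u) (- algebra_part u)"
definition times_unitization :: "'a unitization \<Rightarrow> 'a unitization \<Rightarrow> 'a unitization" where
  "u * v = Unitization (scalar_part u * scalar_part v)
     (scalar_part u *\<^sub>C algebra_part v + scalar_part v *\<^sub>C algebra_part u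
       + algebra_part u * algebra_part v)"
definition scaleR_unitization :: "real \<Rightarrow> 'a unitization \<Rightarrow> 'a unitization" where
  "r *\<^sub>R u = Unitization (r *\<^sub>R scalar_part u) (r *\<^sub>R algebra_part u)"
definition scaleC_unitization :: "complex \<Rightarrow> 'a unitization \<Rightarrow> 'a unitization" where
  "c *\<^sub>C u = Unitization (c * scalar_part u) (c *\<^sub>C algebra_part u)"

lemmas unitization_defs = zero_unitization_def one_unitization_def plus_unitization_def
  minus_unitization_def uminus_unitization_def times_unitization_def scaleR_unitization_def
  scaleC_unitization_def

instance
  by standard
    (simp_all add: unitization_defs unitization_eq_iff algebra_simps scaleC_add_left
      scaleC_add_right scaleC_scaleC scaleC_one scaleR_scaleC mult_scaleC_left mult_scaleC_right
      scaleR_conv_of_real)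

end

text \<open>Left multiplication by the formal sum; the original algebra is an ideal, so it is mapped
  into itself.\<close>

definition unitization_act :: "'a::cstar_algebra unitization \<Rightarrow> 'a \<Rightarrow> 'a" where
  "unitization_act u x = scalar_part u *\<^sub>C x + algebra_part u * x"

lemma unitization_act_simps:
  "unitization_act 0 x = 0"
  "unitization_act 1 x = x"
  "unitization_act (u + v) x = unitization_act u x + unitization_act v x"
  "unitization_act (u * v) x = unitization_act u (unitization_act v x)"
  "unitization_act (r *\<^sub>R u) x = r *\<^sub>R unitization_act u x"
  "unitization_act (c *\<^sub>C u) x = c *\<^sub>C unitization_act u x"
  by (simp_all add: unitization_act_def unitization_defs algebra_simps scaleC_add_left
      scaleC_add_right scaleC_scaleC scaleC_one scaleR_scaleC mult_scaleC_left mult_scaleC_right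
      scaleR_conv_of_real)

lemma norm_unitization_act_le:
  "norm (unitization_act u x) \<le> norm x * (cmod (scalar_part u) + norm (algebra_part u))"
proof -
  have "norm (unitization_act u x)
      \<le> cmod (scalar_part u) * norm x + norm (algebra_part u) * norm x"
    unfolding unitization_act_def
    by (intro norm_triangle_mono norm_mult_ineq) (simp add: norm_scaleC)
  then show ?thesis by (simp add: algebra_simps)
qed

lemma bounded_linear_unitization_act: "bounded_linear (unitization_act u)"
  by (rule bounded_linear_intro[OF _ _ norm_unitization_act_le])
     (simp_all add: unitization_act_def scaleC_add_right distrib_left scaleR_add_right
       scaleR_scaleC_commute)

lemma norm_unitization_act_onorm: "norm (unitization_act u x) \<le> onorm (unitization_act u) * norm x"
  by (rule onorm[OF bounded_linear_unitization_act])

text \<open>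
  The left regular representation alone is not faithful when the algebra already has a unit; taking
  the maximum with the scalar part repairs this.
\<close>

instantiation unitization :: (cstar_algebra) real_normed_algebra_1
begin

definition norm_unitization :: "'a unitization \<Rightarrow> real" where
  "norm u = max (cmod (scalar_part u)) (onorm (unitization_act u))"
definition dist_unitization :: "'a unitization \<Rightarrow> 'a unitization \<Rightarrow> real" where
  "dist_unitization u v = norm (u - v)"
definition sgn_unitization :: "'a unitization \<Rightarrow> 'a unitization" where
  "sgn_unitization u = u /\<^sub>R norm u"
definition uniformity_unitization :: "('a unitization \<times> 'a unitization) filter" where
  "uniformity_unitization = (INF e\<in>{0 <..}. principal {(u, v). dist u v < e})"
definition open_unitization :: "'a unitization set \<Rightarrow> bool" where
  "open_unitization U \<longleftrightarrow> (\<forall>u\<in>U. eventually (\<lambda>(u', v). u' = u \<longrightarrow> v \<in> U) uniformity)"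

instance
proof
  fix u v :: "'a unitization" and r :: real
  show "norm u = 0 \<longleftrightarrow> u = 0"
  proof
    assume "norm u = 0"
    then have s: "scalar_part u = 0" and o: "onorm (unitization_act u) \<le> 0"
      by (simp_all add: norm_unitization_def max_def split: if_splits)
    \<comment> \<open>With zero scalar part, testing the operator on the adjoint of the algebra part
      a yields \<open>a * cstar a\<close>, which vanishes only for a = 0.\<close>
    have "norm (unitization_act u (cstar (algebra_part u))) \<le> 0"
      using norm_unitization_act_onorm[of u "cstar (algebra_part u)"] o
      by (metis dual_order.trans mult_nonneg_nonpos norm_ge_zero mult.commute)
    then have "norm (cstar (cstar (algebra_part u)) * cstar (algebra_part u)) = 0"
      by (simp add: unitization_act_def s cstar_involutive)
    then show "u = 0"
      by (simp add: s unitization_eq_iff zero_unitization_def cstar_identity)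
  next
    assume "u = 0"
    moreover have "unitization_act 0 = (\<lambda>x::'a. 0)"
      by (simp add: fun_eq_iff unitization_act_simps)
    ultimately show "norm u = 0"
      by (simp add: norm_unitization_def onorm_zero) (simp add: zero_unitization_def)
  qed
  show "norm (u + v) \<le> norm u + norm v"
  proof -
    have "unitization_act (u + v) = (\<lambda>x. unitization_act u x + unitization_act v x)"
      by (simp add: fun_eq_iff unitization_act_simps)
    then have "onorm (unitization_act (u + v)) \<le> onorm (unitization_act u) + onorm (unitization_act v)"
      using onorm_triangle[OF bounded_linear_unitization_act[of u] bounded_linear_unitization_act[of v]]
      by simp
    moreover have "cmod (scalar_part (u + v)) \<le> cmod (scalar_part u) + cmod (scalar_part v)"
      by (simp add: plus_unitization_def norm_triangle_ineq)
    ultimately show ?thesis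
      unfolding norm_unitization_def by linarith
  qed
  show "norm (r *\<^sub>R u) = \<bar>r\<bar> * norm u"
  proof -
    have "unitization_act (r *\<^sub>R u) = (\<lambda>x. r *\<^sub>R unitization_act u x)"
      by (simp add: fun_eq_iff unitization_act_simps)
    then have "onorm (unitization_act (r *\<^sub>R u)) = \<bar>r\<bar> * onorm (unitization_act u)"
      using onorm_scaleR[OF bounded_linear_unitization_act[of u], of r] by simp
    moreover have "cmod (scalar_part (r *\<^sub>R u)) = \<bar>r\<bar> * cmod (scalar_part u)"
      by (simp add: scaleR_unitization_def)
    ultimately show ?thesis
      by (simp add: norm_unitization_def max_mult_distrib_left)
  qed
  show "norm (u * v) \<le> norm u * norm v"
  proof -
    have "unitization_act (u * v) = unitization_act u \<circ> unitization_act v"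
      by (simp add: fun_eq_iff unitization_act_simps)
    then have "onorm (unitization_act (u * v)) \<le> onorm (unitization_act u) * onorm (unitization_act v)"
      using onorm_compose[OF bounded_linear_unitization_act[of u] bounded_linear_unitization_act[of v]]
      by simp
    also have "\<dots> \<le> norm u * norm v"
      unfolding norm_unitization_def
      by (intro mult_mono) (auto simp: onorm_pos_le bounded_linear_unitization_act le_max_iff_disj)
    finally have "onorm (unitization_act (u * v)) \<le> norm u * norm v" .
    moreover have "cmod (scalar_part (u * v)) \<le> norm u * norm v"
      unfolding norm_unitization_def times_unitization_def
      by (auto simp: norm_mult le_max_iff_disj intro!: mult_mono)
    ultimately show ?thesis
      by (simp add: norm_unitization_def[of "u * v"])
  qed
  show "norm (1::'a unitization) = 1"
  proof -
    have "unitization_act 1 = (\<lambda>x::'a. x)"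
      by (simp add: fun_eq_iff unitization_act_simps)
    \<comment> \<open>On the zero algebra this operator norm is 0, so the value 1 is supplied by the
      scalar part and an upper bound suffices.\<close>
    moreover have "onorm (\<lambda>x::'a. x) \<le> 1"
      by (rule onorm_id_le)
    ultimately show ?thesis
      by (simp add: norm_unitization_def) (simp add: one_unitization_def)
  qed
  show "r *\<^sub>R u * v = r *\<^sub>R (u * v)" "u * r *\<^sub>R v = r *\<^sub>R (u * v)"
    by (simp_all add: unitization_defs scaleR_scaleC scaleC_scaleC mult_scaleC_left
        mult_scaleC_right scaleC_add_right mult.commute scaleR_conv_of_real mult.left_commute)
qed (simp_all add: dist_unitization_def sgn_unitization_def uniformity_unitization_def
    open_unitization_def)

end

section \<open>The isometric embedding and completeness of the unitization\<close>

definition unitization_embed :: "'a::cstar_algebra \<Rightarrow> 'a unitization" where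
  "unitization_embed a = Unitization 0 a"

lemma unitization_embed_simps:
  "unitization_embed (a + b) = unitization_embed a + unitization_embed b"
  "unitization_embed (a - b) = unitization_embed a - unitization_embed b"
  "unitization_embed (a * b) = unitization_embed a * unitization_embed b"
  "unitization_embed (r *\<^sub>R a) = r *\<^sub>R unitization_embed a"
  by (simp_all add: unitization_embed_def unitization_defs)

text \<open>Submultiplicativity gives the upper bound for left multiplication by a; testing it on
  \<open>cstar a\<close> and using the C*-identity gives the lower one.\<close>

lemma norm_unitization_embed [simp]: "norm (unitization_embed a) = norm a"
proof -
  have act: "unitization_act (unitization_embed a) = (\<lambda>x. a * x)"
    by (simp add: fun_eq_iff unitization_act_def unitization_embed_def)
  have le: "onorm (\<lambda>x. a * x) \<le> norm a"
    by (rule onorm_bound) (simp_all add: norm_mult_ineq)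
  have "norm a * norm a \<le> onorm (\<lambda>x. a * x) * norm a"
    using norm_unitization_act_onorm[of "unitization_embed a" "cstar a"] cstar_identity[of "cstar a"]
    by (simp add: act cstar_involutive power2_eq_square)
  then have "norm a \<le> onorm (\<lambda>x. a * x)"
    using onorm_pos_le[OF bounded_linear_unitization_act[of "unitization_embed a"]]
    by (cases "a = 0") (simp_all add: act onorm_zero)
  then have "onorm (\<lambda>x. a * x) = norm a"
    using le by simp
  then show ?thesis
    unfolding norm_unitization_def act by (simp add: unitization_embed_def)
qed

lemma norm_unitization_le: "norm u \<le> cmod (scalar_part u) + norm (algebra_part u)"
proof -
  have "onorm (unitization_act u) \<le> cmod (scalar_part u) + norm (algebra_part u)"
    by (rule onorm_bound) (use norm_unitization_act_le in \<open>simp_all add: mult.commute\<close>)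
  then show ?thesis by (simp add: norm_unitization_def)
qed

lemma norm_scalar_part_le: "cmod (scalar_part u) \<le> norm u"
  by (simp add: norm_unitization_def)

text \<open>Subtracting the scalar part costs at most another \<open>norm u\<close>, whence the
  factor 2. With the two preceding bounds, the norm is equivalent to the sum of the component
  norms.\<close>

lemma norm_algebra_part_le: "norm (algebra_part u) \<le> 2 * norm u"
proof -
  have "unitization_embed (algebra_part u) = u - Unitization (scalar_part u) 0"
    by (simp add: unitization_embed_def minus_unitization_def)
  then have "norm (algebra_part u) \<le> norm u + norm (Unitization (scalar_part u) (0::'a))"
    by (metis norm_triangle_ineq4 norm_unitization_embed)
  also have "\<dots> \<le> norm u + norm u"
    using norm_unitization_le[of "Unitization (scalar_part u) (0::'a)"] norm_scalar_part_le[of u]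
    by simp
  finally show ?thesis by simp
qed

instance unitization :: (cstar_algebra) banach
proof
  fix X :: "nat \<Rightarrow> 'a unitization"
  assume X: "Cauchy X"
  have "Cauchy (\<lambda>n. scalar_part (X n))"
  proof (rule metric_CauchyI)
    fix e :: real assume "0 < e"
    then obtain M where M: "\<And>m n. M \<le> m \<Longrightarrow> M \<le> n \<Longrightarrow> dist (X m) (X n) < e"
      using metric_CauchyD[OF X] by blast
    have "dist (scalar_part (X m)) (scalar_part (X n)) \<le> dist (X m) (X n)" for m n
      using norm_scalar_part_le[of "X m - X n"] by (simp add: dist_norm minus_unitization_def)
    then show "\<exists>M. \<forall>m\<ge>M. \<forall>n\<ge>M. dist (scalar_part (X m)) (scalar_part (X n)) < e"
      using M by (meson order_le_less_trans)
  qed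
  then obtain l where l: "(\<lambda>n. scalar_part (X n)) \<longlonglongrightarrow> l"
    by (meson Cauchy_convergent convergent_def)
  have "Cauchy (\<lambda>n. algebra_part (X n))"
  proof (rule metric_CauchyI)
    fix e :: real assume "0 < e"
    \<comment> \<open>The radius e / 2 compensates for the factor 2 in the bound on the algebra
      part.\<close>
    then obtain M where M: "\<And>m n. M \<le> m \<Longrightarrow> M \<le> n \<Longrightarrow> dist (X m) (X n) < e / 2"
      using metric_CauchyD[OF X, of "e / 2"] by auto
    have "dist (algebra_part (X m)) (algebra_part (X n)) < e" if "M \<le> m" "M \<le> n" for m n
      using norm_algebra_part_le[of "X m - X n"] M[OF that]
      by (simp add: dist_norm minus_unitization_def)
    then show "\<exists>M. \<forall>m\<ge>M. \<forall>n\<ge>M. dist (algebra_part (X m)) (algebra_part (X n)) < e"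
      by blast
  qed
  then obtain a where a: "(\<lambda>n. algebra_part (X n)) \<longlonglongrightarrow> a"
    by (meson Cauchy_convergent convergent_def)
  have lim: "(\<lambda>n. cmod (scalar_part (X n) - l) + norm (algebra_part (X n) - a)) \<longlonglongrightarrow> 0"
    by (intro tendsto_add_zero tendsto_norm_zero LIM_zero l a)
  have le: "norm (X n - Unitization l a)
      \<le> cmod (scalar_part (X n) - l) + norm (algebra_part (X n) - a)" for n
    using norm_unitization_le[of "X n - Unitization l a"] by (simp add: minus_unitization_def)
  have "(\<lambda>n. X n - Unitization l a) \<longlonglongrightarrow> 0"
    by (rule Lim_null_comparison[OF always_eventually[OF allI[OF le]] lim])
  then have "X \<longlonglongrightarrow> Unitization l a"
    by (rule LIM_zero_cancel)
  then show "convergent X"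
    by (rule convergentI)
qed

section \<open>The involution and the C*-identity on the unitization\<close>

instantiation unitization :: (cstar_algebra) cstar_algebra
begin

definition cstar_unitization :: "'a unitization \<Rightarrow> 'a unitization" where
  "cstar u = Unitization (cnj (scalar_part u)) (cstar (algebra_part u))"

lemma cstar_unitization_mult: "cstar (u * v) = cstar v * cstar (u :: 'a unitization)"
  by (simp add: cstar_unitization_def times_unitization_def cstar_add cstar_scaleC cstar_mult
      mult.commute add.commute)

text \<open>For the pairing \<open>cstar x * y\<close>, the operator of \<open>cstar u\<close> is
  the adjoint of the operator of u.\<close>

lemma cstar_unitization_act:
  "cstar (unitization_act u x) * y = cstar x * unitization_act (cstar u) (y :: 'a)"
  by (simp add: unitization_act_def cstar_unitization_def cstar_add cstar_scaleC cstar_mult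
      distrib_left distrib_right mult_scaleC_left mult_scaleC_right mult.assoc)

text \<open>By the adjoint relation the squared norm of ux equals that of \<open>cstar x\<close>
  times (\<open>cstar u * u\<close>) x, which is at most the operator norm of
  \<open>cstar u * u\<close> times (norm x)^2.\<close>

lemma onorm_unitization_act_square_le:
  "(onorm (unitization_act u))\<^sup>2 \<le> onorm (unitization_act (cstar u * (u :: 'a unitization)))"
proof -
  let ?q = "onorm (unitization_act (cstar u * u))"
  have q: "0 \<le> ?q"
    by (rule onorm_pos_le[OF bounded_linear_unitization_act])
  have "norm (unitization_act u x) \<le> sqrt ?q * norm x" for x
  proof -
    have "(norm (unitization_act u x))\<^sup>2 = norm (cstar x * unitization_act (cstar u * u) x)"
      unfolding cstar_identity[symmetric] cstar_unitization_act by (simp add: unitization_act_simps)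
    also have "\<dots> \<le> norm x * norm (unitization_act (cstar u * u) x)"
      using norm_mult_ineq[of "cstar x"] by simp
    also have "\<dots> \<le> norm x * (?q * norm x)"
      by (intro mult_left_mono norm_unitization_act_onorm norm_ge_zero)
    also have "\<dots> = (sqrt ?q * norm x)\<^sup>2"
      using q by (simp add: power_mult_distrib) (simp add: power2_eq_square)
    finally show ?thesis
      by (rule power2_le_imp_le) (simp add: q)
  qed
  then have "onorm (unitization_act u) \<le> sqrt ?q"
    by (intro onorm_bound) (simp_all add: q)
  then have "(onorm (unitization_act u))\<^sup>2 \<le> (sqrt ?q)\<^sup>2"
    by (intro power_mono onorm_pos_le bounded_linear_unitization_act)
  then show ?thesis using q by simp
qed

text \<open>Writing N for the operator norm, N(u)^2 is at most N(\<open>cstar u * u\<close>), hence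
  at most N(\<open>cstar u\<close>) N(u). Cancelling N(u) gives the first claim, and N(u) = 0 is
  trivial.\<close>

lemma onorm_unitization_act_cstar_le:
  "onorm (unitization_act (u :: 'a unitization)) \<le> onorm (unitization_act (cstar u))"
  and onorm_unitization_act_mult_le:
  "onorm (unitization_act (cstar u * u)) \<le> onorm (unitization_act (cstar u)) * onorm (unitization_act u)"
proof -
  have "unitization_act (cstar u * u) = unitization_act (cstar u) \<circ> unitization_act u"
    by (simp add: fun_eq_iff unitization_act_simps)
  then show le: "onorm (unitization_act (cstar u * u))
      \<le> onorm (unitization_act (cstar u)) * onorm (unitization_act u)"
    using onorm_compose[OF bounded_linear_unitization_act bounded_linear_unitization_act] by metis
  have "onorm (unitization_act u) * onorm (unitization_act u)
      \<le> onorm (unitization_act (cstar u)) * onorm (unitization_act u)"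
    using le onorm_unitization_act_square_le[of u] by (simp add: power2_eq_square)
  then show "onorm (unitization_act u) \<le> onorm (unitization_act (cstar u))"
    using onorm_pos_le[OF bounded_linear_unitization_act[of u]]
      onorm_pos_le[OF bounded_linear_unitization_act[of "cstar u"]]
    by (metis mult_le_cancel_right order_le_less)
qed

instance
proof
  fix u v :: "'a unitization" and c :: complex
  show inv: "cstar (cstar u) = u" for u :: "'a unitization"
    by (simp add: cstar_unitization_def cstar_involutive)
  show "cstar (u + v) = cstar u + cstar v"
    by (simp add: cstar_unitization_def plus_unitization_def cstar_add)
  show "cstar (c *\<^sub>C u) = cnj c *\<^sub>C cstar u"
    by (simp add: cstar_unitization_def scaleC_unitization_def cstar_scaleC)
  show "cstar (u * v) = cstar v * cstar u"
    by (rule cstar_unitization_mult)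
  show "c *\<^sub>C u * v = c *\<^sub>C (u * v)" "u * c *\<^sub>C v = c *\<^sub>C (u * v)"
    by (simp_all add: unitization_defs scaleC_scaleC mult_scaleC_left
        mult_scaleC_right scaleC_add_right mult.commute mult.left_commute)
  show "norm (cstar u * u) = (norm u)\<^sup>2"
  proof -
    have "onorm (unitization_act (cstar u)) = onorm (unitization_act u)"
      using onorm_unitization_act_cstar_le[of u] onorm_unitization_act_cstar_le[of "cstar u"]
      by (simp add: inv)
    then have "onorm (unitization_act (cstar u * u)) = (onorm (unitization_act u))\<^sup>2"
      using onorm_unitization_act_mult_le[of u] onorm_unitization_act_square_le[of u]
      by (simp add: power2_eq_square)
    moreover have "cmod (scalar_part (cstar u * u)) = (cmod (scalar_part u))\<^sup>2"
      by (simp add: cstar_unitization_def times_unitization_def norm_mult power2_eq_square)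
    \<comment> \<open>The operator norm and the modulus of the scalar part both satisfy the
      C*-identity, and squaring commutes with taking their maximum.\<close>
    moreover have "max (s\<^sup>2) (t\<^sup>2) = (max s t)\<^sup>2" if "0 \<le> s" "0 \<le> t" for s t :: real
      using that by (simp add: max_def)
    ultimately show ?thesis
      by (simp add: norm_unitization_def onorm_pos_le bounded_linear_unitization_act)
  qed
  show "norm (c *\<^sub>C u) = cmod c * norm u"
  proof -
    have le: "norm (c *\<^sub>C u) \<le> cmod c * norm u" for c and u :: "'a unitization"
    proof -
      have "onorm (unitization_act (c *\<^sub>C u)) \<le> cmod c * onorm (unitization_act u)"
        by (rule onorm_bound)
          (auto simp: unitization_act_simps norm_scaleC mult.assoc onorm_pos_le
            bounded_linear_unitization_act intro!: mult_left_mono norm_unitization_act_onorm)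
      also have "\<dots> \<le> cmod c * norm u"
        by (intro mult_left_mono) (simp_all add: norm_unitization_def)
      finally have "onorm (unitization_act (c *\<^sub>C u)) \<le> cmod c * norm u" .
      moreover have "cmod (scalar_part (c *\<^sub>C u)) \<le> cmod c * norm u"
        using norm_scalar_part_le[of u]
        by (simp add: scaleC_unitization_def norm_mult mult_left_mono)
      ultimately show ?thesis
        by (simp add: norm_unitization_def[of "c *\<^sub>C u"])
    qed
    show ?thesis
    proof (cases "c = 0")
      case False
      \<comment> \<open>The reverse inequality is the same bound for the scalar
        \<open>inverse c\<close>.\<close>
      have "u = inverse c *\<^sub>C (c *\<^sub>C u)"
        using False by (simp add: scaleC_scaleC scaleC_one)
      then have "norm u \<le> cmod (inverse c) * norm (c *\<^sub>C u)"
        using le by metis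
      then have "cmod c * norm u \<le> norm (c *\<^sub>C u)"
        using False by (simp add: norm_inverse norm_divide field_simps)
      then show ?thesis using le[of c u] by simp
    qed simp
  qed
qed

end

lemma unitization_embed_cstar: "unitization_embed (cstar a) = cstar (unitization_embed a)"
  by (simp add: unitization_embed_def cstar_unitization_def)

text \<open>The embedding respects products and adjoints, so Kaplansky's theorem applies in the
  unitization.\<close>

lemma cstar_nonneg_unitization_embed:
  "cstar_pos a \<Longrightarrow> cstar_nonneg (unitization_embed a)"
  by (auto simp: cstar_pos_def unitization_embed_simps unitization_embed_cstar
      cstar_nonneg_cstar_mult_self)

section \<open>The norm of a Hilbert module\<close>

locale hilbert_cstar_module =
  fixes act :: "'a::cstar_algebra \<Rightarrow> 'x::complex_vector \<Rightarrow> 'x"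
    and ip :: "'x \<Rightarrow> 'x \<Rightarrow> 'a"
  assumes hilbert_module: "hilbert_module act ip"
begin

abbreviation nrm :: "'x \<Rightarrow> real" where
  "nrm \<equiv> hm_norm ip"

lemma act_add_right: "act a (x + y) = act a x + act a y"
  and act_add_left: "act (a + b) x = act a x + act b x"
  and scaleC_act_left: "c *\<^sub>C act a x = act (c *\<^sub>C a) x"
  and scaleC_act_right: "c *\<^sub>C act a x = act a (c *\<^sub>C x)"
  and ip_add_left: "ip (x + y) z = ip x z + ip y z"
  and ip_scaleC_left: "ip (c *\<^sub>C x) y = c *\<^sub>C ip x y"
  and ip_act_left: "ip (act a x) y = a * ip x y"
  and cstar_ip: "cstar (ip x y) = ip y x"
  and ip_pos: "cstar_pos (ip x x)"
  and ip_self_eq_0_iff: "ip x x = 0 \<longleftrightarrow> x = 0"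
  using hilbert_module unfolding hilbert_module_def by (elim conjE; iprover)+

lemma nrm_complete:
  fixes X :: "nat \<Rightarrow> 'x"
  assumes "\<And>e. e > 0 \<Longrightarrow> \<exists>N. \<forall>m\<ge>N. \<forall>n\<ge>N. nrm (X m - X n) < e"
  obtains l where "\<And>e. e > 0 \<Longrightarrow> \<exists>N. \<forall>n\<ge>N. nrm (X n - l) < e"
proof -
  have "\<forall>X :: nat \<Rightarrow> 'x. (\<forall>e>0. \<exists>N. \<forall>m\<ge>N. \<forall>n\<ge>N. nrm (X m - X n) < e) \<longrightarrow>
      (\<exists>l. \<forall>e>0. \<exists>N. \<forall>n\<ge>N. nrm (X n - l) < e)"
    using hilbert_module unfolding hilbert_module_def by (elim conjE)
  then have "\<exists>l. \<forall>e>0. \<exists>N. \<forall>n\<ge>N. nrm (X n - l) < e"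
    using assms by (elim allE[of _ X] impE) simp_all
  then show thesis
    using that by blast
qed

lemma ip_add_right: "ip x (y + z) = ip x y + ip x z"
  using cstar_add[of "ip y x" "ip z x"] by (simp add: cstar_ip flip: ip_add_left)

lemma ip_scaleC_right: "ip x (c *\<^sub>C y) = cnj c *\<^sub>C ip x y"
  using cstar_scaleC[of c "ip y x"] by (simp add: cstar_ip flip: ip_scaleC_left)

lemma ip_act_right: "ip x (act a y) = ip x y * cstar a"
  using cstar_mult[of a "ip y x"] by (simp add: cstar_ip flip: ip_act_left)

lemma ip_diff_left: "ip (x - y) z = ip x z - ip y z"
  using ip_add_left[of "x - y" y z] by simp

lemma ip_diff_right: "ip x (y - z) = ip x y - ip x z"
  using ip_add_right[of x "y - z" z] by simp

lemma act_diff_right: "act a (x - y) = act a x - act a y"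
  using act_add_right[of a "x - y" y] by simp

lemma act_diff_left: "act (a - b) x = act a x - act b x"
  using act_add_left[of "a - b" b x] by simp

lemma ip_zero_left: "ip 0 y = 0"
  using ip_diff_left[of 0 0 y] by simp

text \<open>
  Expand \<open>0 \<le> \<langle>ax - y, ax - y\<rangle>\<close> for \<open>a = \<langle>y, x\<rangle> / s\<close> with \<open>s = \<parallel>\<langle>x, x\<rangle>\<parallel>\<close>, and add the
  nonnegative element \<open>\<langle>x, y\<rangle>\<^sup>* (s - \<langle>x, x\<rangle>) \<langle>x, y\<rangle> / s\<^sup>2\<close>.
\<close>

lemma ip_Cauchy_Schwarz: "(norm (ip x y))\<^sup>2 \<le> norm (ip x x) * norm (ip y y)"
proof (cases "x = 0")
  case True
  then show ?thesis by (simp add: ip_zero_left)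
next
  case False
  define s where "s = norm (ip x x)"
  have s: "0 < s"
    using False ip_self_eq_0_iff by (simp add: s_def)
  \<comment> \<open>The term \<open>s *\<^sub>R 1\<close> needs a unit, so the computation moves to
    the unitization.\<close>
  define p where "p = unitization_embed (ip x x)"
  define q where "q = unitization_embed (ip y y)"
  define r where "r = unitization_embed (ip x y)"
  have r': "unitization_embed (ip y x) = cstar r"
    by (simp add: r_def cstar_ip flip: unitization_embed_cstar)
  define z where "z = act ((1/s) *\<^sub>R ip y x) x - y"
  have "ip z z = (1/s) *\<^sub>R ip y x * ip x x * (1/s) *\<^sub>R ip x y - (1/s) *\<^sub>R ip y x * ip x y
      - ip y x * (1/s) *\<^sub>R ip x y + ip y y"
    unfolding z_def
    by (simp add: ip_diff_left ip_diff_right ip_act_left ip_act_right cstar_scaleR cstar_ip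
        algebra_simps)
  then have "unitization_embed (ip z z)
      = (1/s) *\<^sub>R cstar r * p * (1/s) *\<^sub>R r - (1/s) *\<^sub>R cstar r * r - cstar r * (1/s) *\<^sub>R r + q"
    by (simp only: unitization_embed_simps r' p_def q_def r_def)
  \<comment> \<open>The added element cancels the term containing p and changes the coefficient of
    \<open>cstar r * r\<close> from -2/s to -1/s.\<close>
  then have "unitization_embed (ip z z) + (1/s\<^sup>2) *\<^sub>R (cstar r * (s *\<^sub>R 1 - p) * r)
      = q - (1/s) *\<^sub>R (cstar r * r)"
    using s by (simp add: algebra_simps power2_eq_square)
  moreover have "cstar_nonneg (unitization_embed (ip z z))"
    by (intro cstar_nonneg_unitization_embed ip_pos)
  moreover have "cstar_nonneg ((1/s\<^sup>2) *\<^sub>R (cstar r * (s *\<^sub>R 1 - p) * r))"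
    by (intro cstar_nonneg_scaleR cstar_nonneg_conjugate cstar_nonneg_norm_minus)
       (simp_all add: p_def s_def cstar_ip flip: unitization_embed_cstar)
  ultimately have "cstar_nonneg (q - (1/s) *\<^sub>R (cstar r * r))"
    using cstar_nonneg_add by metis
  moreover have "cstar_nonneg ((1/s) *\<^sub>R (cstar r * r))"
    using s by (intro cstar_nonneg_scaleR cstar_nonneg_cstar_mult_self) simp
  ultimately have "norm ((1/s) *\<^sub>R (cstar r * r)) \<le> norm q"
    by (intro cstar_norm_mono)
  then show ?thesis
    using s by (simp add: cstar_identity r_def q_def s_def field_simps)
qed

lemma nrm_nonneg [simp]: "0 \<le> nrm x"
  by (simp add: hm_norm_def)

lemma nrm_power2: "(nrm x)\<^sup>2 = norm (ip x x)"
  by (simp add: hm_norm_def)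

lemma nrm_eq_0_iff [simp]: "nrm x = 0 \<longleftrightarrow> x = 0"
  by (simp add: hm_norm_def ip_self_eq_0_iff)

lemma nrm_zero [simp]: "nrm 0 = 0"
  by simp

lemma norm_ip_le: "norm (ip x y) \<le> nrm x * nrm y"
  by (rule power2_le_imp_le) (simp_all add: power_mult_distrib nrm_power2 ip_Cauchy_Schwarz)

lemma nrm_triangle: "nrm (x + y) \<le> nrm x + nrm y"
proof (rule power2_le_imp_le)
  have "(nrm (x + y))\<^sup>2 = norm ((ip x x + ip x y) + (ip y x + ip y y))"
    by (simp add: nrm_power2 ip_add_left ip_add_right algebra_simps)
  also have "\<dots> \<le> (norm (ip x x) + norm (ip x y)) + (norm (ip y x) + norm (ip y y))"
    by (intro norm_triangle_mono norm_triangle_ineq)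
  also have "\<dots> \<le> (nrm x + nrm y)\<^sup>2"
    using norm_ip_le[of x y] norm_ip_le[of y x]
    by (simp add: power2_sum nrm_power2 mult.commute[of "nrm y"])
  finally show "(nrm (x + y))\<^sup>2 \<le> (nrm x + nrm y)\<^sup>2" .
qed simp

lemma nrm_scaleC: "nrm (c *\<^sub>C x) = cmod c * nrm x"
  by (simp add: hm_norm_def ip_scaleC_left ip_scaleC_right scaleC_scaleC norm_scaleC norm_mult
      real_sqrt_mult)

lemma nrm_minus: "nrm (- x) = nrm x"
  using nrm_scaleC[of "-1" x] by (simp add: scaleC_minus_left scaleC_one)

lemma nrm_minus_commute: "nrm (x - y) = nrm (y - x)"
  using nrm_minus[of "x - y"] by simp

lemma nrm_triangle_via: "nrm (x - z) \<le> nrm (x - y) + nrm (y - z)"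
  using nrm_triangle[of "x - y" "y - z"] by simp

lemma nrm_act_le: "nrm (act a x) \<le> norm a * nrm x"
proof (rule power2_le_imp_le)
  have "(nrm (act a x))\<^sup>2 = norm (a * ip x x * cstar a)"
    by (simp add: nrm_power2 ip_act_left ip_act_right mult.assoc)
  also have "\<dots> \<le> norm a * norm (ip x x) * norm a"
    using norm_mult_ineq[of "a * ip x x" "cstar a"]
      mult_right_mono[OF norm_mult_ineq[of a "ip x x"] norm_ge_zero[of a]] by simp
  also have "\<dots> = (norm a * nrm x)\<^sup>2"
    by (simp add: power_mult_distrib nrm_power2[symmetric] power2_eq_square)
  finally show "(nrm (act a x))\<^sup>2 \<le> (norm a * nrm x)\<^sup>2" .
qed simp

section \<open>Convergence in the module norm\<close>

text \<open>The norm depends on \<open>ip\<close> and not on the type alone, so convergence is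
  reduced to that of a real sequence.\<close>

definition nrm_tendsto :: "(nat \<Rightarrow> 'x) \<Rightarrow> 'x \<Rightarrow> bool" where
  "nrm_tendsto X l \<longleftrightarrow> (\<lambda>n. nrm (X n - l)) \<longlonglongrightarrow> 0"

lemma nrm_tendstoI:
  assumes "\<And>n. nrm (X n - l) \<le> g n" "g \<longlonglongrightarrow> 0"
  shows "nrm_tendsto X l"
  unfolding nrm_tendsto_def
  by (rule tendsto_sandwich[OF _ _ tendsto_const assms(2)]) (simp_all add: assms(1))

lemma nrm_tendsto_scaleC:
  assumes "nrm_tendsto X l"
  shows "nrm_tendsto (\<lambda>n. c *\<^sub>C X n) (c *\<^sub>C l)"
  using tendsto_mult_right_zero[OF assms[unfolded nrm_tendsto_def], of "cmod c"]
  by (simp add: nrm_tendsto_def nrm_scaleC flip: scaleC_diff_right)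

lemma nrm_tendsto_diff:
  assumes "nrm_tendsto X l" "nrm_tendsto Y m"
  shows "nrm_tendsto (\<lambda>n. X n - Y n) (l - m)"
proof (rule nrm_tendstoI)
  show "nrm (X n - Y n - (l - m)) \<le> nrm (X n - l) + nrm (Y n - m)" for n
    using nrm_triangle[of "X n - l" "- (Y n - m)"] unfolding nrm_minus by (simp add: algebra_simps)
  show "(\<lambda>n. nrm (X n - l) + nrm (Y n - m)) \<longlonglongrightarrow> 0"
    using assms unfolding nrm_tendsto_def by (rule tendsto_add_zero)
qed

lemma nrm_tendsto_subseq:
  assumes "nrm_tendsto X l" "strict_mono r"
  shows "nrm_tendsto (\<lambda>n. X (r n)) l"
  using LIMSEQ_subseq_LIMSEQ[OF assms(1)[unfolded nrm_tendsto_def] assms(2)]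
  by (simp add: nrm_tendsto_def o_def)

lemma nrm_tendsto_le:
  assumes "nrm_tendsto X l" "\<And>n. nrm (X n) \<le> g n" "g \<longlonglongrightarrow> b"
  shows "nrm l \<le> b"
proof (rule LIMSEQ_le_const)
  show "(\<lambda>n. nrm (X n - l) + g n) \<longlonglongrightarrow> b"
    using tendsto_add[OF assms(1)[unfolded nrm_tendsto_def] assms(3)] by simp
  have "nrm l \<le> nrm (X n - l) + g n" for n
    using nrm_triangle_via[of l 0 "X n"] assms(2)[of n] by (simp add: nrm_minus_commute)
  then show "\<exists>N. \<forall>n\<ge>N. nrm l \<le> nrm (X n - l) + g n" by blast
qed

lemma nrm_tendsto_eq_0:
  assumes "nrm_tendsto X l" "\<And>n. nrm (X n) \<le> g n" "g \<longlonglongrightarrow> 0"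
  shows "l = 0"
  using order_antisym[OF nrm_tendsto_le[OF assms] nrm_nonneg] by simp

lemma tendsto_ip:
  assumes "nrm_tendsto X l" "nrm_tendsto Y m"
  shows "(\<lambda>n. ip (X n) (Y n)) \<longlonglongrightarrow> ip l m"
proof -
  note X = assms(1)[unfolded nrm_tendsto_def] and Y = assms(2)[unfolded nrm_tendsto_def]
  have le: "norm (ip (X n) (Y n) - ip l m)
      \<le> nrm (X n - l) * nrm (Y n - m) + nrm (X n - l) * nrm m + nrm l * nrm (Y n - m)" for n
  proof -
    have "ip (X n) (Y n) - ip l m = ip (X n - l) (Y n - m) + ip (X n - l) m + ip l (Y n - m)"
      by (simp add: ip_diff_left ip_diff_right)
    then show ?thesis
      by (simp only:) (intro norm_triangle_mono norm_ip_le)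
  qed
  have lim: "(\<lambda>n. nrm (X n - l) * nrm (Y n - m) + nrm (X n - l) * nrm m + nrm l * nrm (Y n - m))
      \<longlonglongrightarrow> 0"
    by (intro tendsto_add_zero tendsto_mult_zero tendsto_mult_left_zero tendsto_mult_right_zero X Y)
  have "(\<lambda>n. ip (X n) (Y n) - ip l m) \<longlonglongrightarrow> 0"
    by (rule Lim_null_comparison[OF always_eventually[OF allI[OF le]] lim])
  then show ?thesis
    by (rule LIM_zero_cancel)
qed

lemma nrm_tendsto_act:
  assumes "A \<longlonglongrightarrow> a" "nrm_tendsto Z k"
  shows "nrm_tendsto (\<lambda>n. act (A n) (Z n)) (act a k)"
proof (rule nrm_tendstoI)
  show "nrm (act (A n) (Z n) - act a k) \<le> norm (A n) * nrm (Z n - k) + norm (A n - a) * nrm k" for n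
  proof -
    have eq: "act (A n) (Z n) - act a k = act (A n) (Z n - k) + act (A n - a) k"
      by (simp add: act_diff_left act_diff_right)
    show ?thesis
      unfolding eq by (rule order_trans[OF nrm_triangle add_mono[OF nrm_act_le nrm_act_le]])
  qed
  have "(\<lambda>n. norm (A n) * nrm (Z n - k)) \<longlonglongrightarrow> norm a * 0"
    by (intro tendsto_mult tendsto_norm assms(1) assms(2)[unfolded nrm_tendsto_def])
  moreover have "(\<lambda>n. norm (A n - a) * nrm k) \<longlonglongrightarrow> 0"
    by (intro tendsto_mult_left_zero tendsto_norm_zero LIM_zero assms(1))
  ultimately show "(\<lambda>n. norm (A n) * nrm (Z n - k) + norm (A n - a) * nrm k) \<longlonglongrightarrow> 0"
    by (intro tendsto_add_zero) simp_all
qed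

text \<open>The bound is the closed form of the sum of C r^i over m \<le> i < n, so one more term
  extends it to the next n.\<close>

lemma nrm_diff_le_geometric:
  assumes "\<And>n. nrm (X (Suc n) - X n) \<le> C * r ^ n" "0 \<le> r" "r < 1" "m \<le> n"
  shows "nrm (X m - X n) \<le> C * (r ^ m - r ^ n) / (1 - r)"
  using assms(4)
proof (induction n rule: dec_induct)
  case base
  then show ?case by simp
next
  case (step n)
  have "nrm (X m - X (Suc n)) \<le> C * (r ^ m - r ^ n) / (1 - r) + C * r ^ n"
    using nrm_triangle_via[of "X m" "X (Suc n)" "X n"] step.IH assms(1)[of n]
      nrm_minus_commute[of "X n" "X (Suc n)"] by linarith
  also have "\<dots> = C * (r ^ m - r ^ Suc n) / (1 - r)"
    using assms(3) by (simp add: field_simps)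
  finally show ?case .
qed

text \<open>Summing the increments makes the sequence Cauchy; the bound from index 0 survives in the
  limit and later yields the constant of the theorem.\<close>

lemma nrm_tendsto_geometric:
  assumes "\<And>n. nrm (X (Suc n) - X n) \<le> C * r ^ n" "0 \<le> r" "r < 1"
  obtains l where "nrm_tendsto X l" "nrm (X 0 - l) \<le> C / (1 - r)"
proof -
  have C: "0 \<le> C"
    using order_trans[OF nrm_nonneg assms(1)[of 0]] by simp
  have le: "nrm (X m - X n) \<le> C / (1 - r) * r ^ N" if "N \<le> m" "N \<le> n" for m n N
  proof -
    have *: "nrm (X i - X j) \<le> C / (1 - r) * r ^ N" if "N \<le> i" "i \<le> j" for i j
    proof -
      have "nrm (X i - X j) \<le> C / (1 - r) * (r ^ i - r ^ j)"
        using nrm_diff_le_geometric[OF assms that(2)] by simp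
      also have "\<dots> \<le> C / (1 - r) * r ^ N"
      proof (rule mult_left_mono)
        show "r ^ i - r ^ j \<le> r ^ N"
          using power_decreasing[OF that(1), of r] zero_le_power[OF assms(2), of j] assms(2,3)
          by linarith
      qed (use C assms(3) in simp)
      finally show ?thesis .
    qed
    show ?thesis
      using *[of m n] *[of n m] that by (metis nat_le_linear nrm_minus_commute)
  qed
  have lim0: "(\<lambda>N. C / (1 - r) * r ^ N) \<longlonglongrightarrow> 0"
    using assms(2,3) by (intro tendsto_mult_right_zero LIMSEQ_realpow_zero)
  have "\<exists>N. \<forall>m\<ge>N. \<forall>n\<ge>N. nrm (X m - X n) < e" if e: "0 < e" for e
  proof -
    obtain N where "C / (1 - r) * r ^ N < e"
      using order_tendstoD(2)[OF lim0 e] by (auto simp: eventually_sequentially)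
    then show ?thesis
      using le by (meson order_le_less_trans)
  qed
  then obtain l where l: "\<And>e. e > 0 \<Longrightarrow> \<exists>N. \<forall>n\<ge>N. nrm (X n - l) < e"
    using nrm_complete by blast
  then have lim: "nrm_tendsto X l"
    unfolding nrm_tendsto_def by (intro LIMSEQ_I) simp
  have "nrm_tendsto (\<lambda>n. X 0 - X n) (X 0 - l)"
    by (rule nrm_tendsto_diff[OF _ lim]) (simp add: nrm_tendsto_def)
  then have "nrm (X 0 - l) \<le> C / (1 - r)"
    by (rule nrm_tendsto_le[where g = "\<lambda>_. C / (1 - r)"]) (use le[of 0 0] in simp_all)
  with lim show thesis
    by (rule that)
qed

end

section \<open>Stability of homomorphisms\<close>

text \<open>Rotate c to the nonnegative number 2s with s \<le> 1, which is the sum of the conjugate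
  unit numbers s + it and s - it, where s^2 + t^2 = 1.\<close>

lemma complex_eq_sum_of_units:
  assumes "cmod c \<le> 2"
  obtains \<mu> \<nu> where "cmod \<mu> = 1" "cmod \<nu> = 1" "c = \<mu> + \<nu>"
proof -
  \<comment> \<open>\<open>sgn 0\<close> is 0 and not a unit; for c = 0 any direction works.\<close>
  define w where "w = (if c = 0 then 1 else sgn c)"
  define s where "s = cmod c / 2"
  define t where "t = sqrt (1 - s\<^sup>2)"
  have w: "cmod w = 1"
    by (simp add: w_def norm_sgn)
  have c: "c = w * of_real (2 * s)"
    by (simp add: w_def s_def sgn_eq)
  have "s\<^sup>2 \<le> 1"
    using assms by (simp add: s_def abs_square_le_1)
  then have "s\<^sup>2 + t\<^sup>2 = 1"
    by (simp add: t_def)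
  then have "cmod (Complex s t) = 1" "cmod (Complex s (- t)) = 1"
    by (simp_all add: complex_norm)
  moreover have "c = w * Complex s t + w * Complex s (- t)"
    by (simp add: c flip: distrib_left) (simp add: complex_eq_iff)
  ultimately show thesis
    using w by (intro that[of "w * Complex s t" "w * Complex s (- t)"]) (simp_all add: norm_mult)
qed

lemma additive_unit_homogeneous_imp_homogeneous:
  fixes H :: "'x::complex_vector \<Rightarrow> 'y::complex_vector"
  assumes add: "\<And>x y. H (x + y) = H x + H y"
    and unit: "\<And>\<mu> x. cmod \<mu> = 1 \<Longrightarrow> H (\<mu> *\<^sub>C x) = \<mu> *\<^sub>C H x"
  shows "H (c *\<^sub>C x) = c *\<^sub>C H x"
proof -
  have H0: "H 0 = 0"
    using add[of 0 0] by simp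
  have nat: "H (of_nat n *\<^sub>C v) = of_nat n *\<^sub>C H v" for n v
    by (induction n) (simp_all add: H0 add scaleC_add_left unit scaleC_one)
  \<comment> \<open>Division by a large integer brings c into the disc covered by sums of two units;
    additivity handles the integer factor.\<close>
  obtain n :: nat where n: "cmod c < real n"
    using reals_Archimedean2 by blast
  then have n0: "0 < real n"
    using norm_ge_zero[of c] by linarith
  have "cmod (c / of_nat n) \<le> 2"
    using n n0 by (simp add: norm_divide field_simps)
  then obtain \<mu> \<nu> where \<mu>\<nu>: "cmod \<mu> = 1" "cmod \<nu> = 1" "c / of_nat n = \<mu> + \<nu>"
    by (rule complex_eq_sum_of_units)
  then have c: "c = of_nat n * (\<mu> + \<nu>)"
    using n0 by (simp add: field_simps)
  have "H (c *\<^sub>C x) = of_nat n *\<^sub>C H (\<mu> *\<^sub>C x + \<nu> *\<^sub>C x)"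
    unfolding c by (simp add: nat scaleC_add_left flip: scaleC_scaleC)
  also have "\<dots> = of_nat n *\<^sub>C ((\<mu> + \<nu>) *\<^sub>C H x)"
    by (simp add: add unit \<mu>\<nu> scaleC_add_left)
  also have "\<dots> = c *\<^sub>C H x"
    by (simp add: c scaleC_scaleC)
  finally show ?thesis .
qed


theorem theorem2p4:
  fixes actA :: "'a::cstar_algebra \<Rightarrow> 'x::complex_vector \<Rightarrow> 'x"
    and ipA :: "'x \<Rightarrow> 'x \<Rightarrow> 'a"
    and actB :: "'b::cstar_algebra \<Rightarrow> 'y::complex_vector \<Rightarrow> 'y"
    and ipB :: "'y \<Rightarrow> 'y \<Rightarrow> 'b"
    and f :: "'x \<Rightarrow> 'y"
    and \<phi> :: "'x \<Rightarrow> 'x \<Rightarrow> 'x \<Rightarrow> real"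
    and L :: real
  assumes "hilbert_module actA ipA"
    and "hilbert_module actB ipB"
    and "\<And>x y z. \<phi> x y z \<ge> 0"
    and "\<And>\<mu> x y. cmod \<mu> = 1 \<Longrightarrow>
           hm_norm ipB (f (\<mu> *\<^sub>C x + y) - \<mu> *\<^sub>C f x - f y) \<le> \<phi> x y 0"
    and "\<And>x y z. hm_norm ipB (f (actA (ipA x y) z) - actB (ipB (f x) (f y)) (f z)) \<le> \<phi> x y z"
    and "0 \<le> L" and "L < 1"
    and "\<And>x y z. \<phi> x y z \<le> L / 8 * \<phi> (2 *\<^sub>C x) (2 *\<^sub>C y) (2 *\<^sub>C z)"
  shows "\<exists>!H. hilbert_module_hom actA ipA actB ipB H \<and>
              (\<forall>x. hm_norm ipB (f x - H x) \<le> L / (8 - 8 * L) * \<phi> x x 0)"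
proof -
  interpret A: hilbert_cstar_module actA ipA
    by standard (fact assms(1))
  interpret B: hilbert_cstar_module actB ipB
    by standard (fact assms(2))
  note \<phi>_nonneg = assms(3) and f_add = assms(4) and f_mult = assms(5) and L = assms(6,7)
  define sc :: "nat \<Rightarrow> complex" where "sc n = inverse (2 ^ n)" for n
  have two_sc: "2 *\<^sub>C (sc (Suc n) *\<^sub>C v) = sc n *\<^sub>C v" for n and v :: 'x
    by (simp add: sc_def scaleC_scaleC)
  have pow_sc: "2 ^ n * sc n = 1" for n
    by (simp add: sc_def)
  have sc_add: "sc m * sc n = sc (m + n)" for m n
    by (simp add: sc_def power_add)
  have \<phi>_sc: "\<phi> (sc n *\<^sub>C x) (sc n *\<^sub>C y) (sc n *\<^sub>C z) \<le> (L / 8) ^ n * \<phi> x y z" for n x y z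
  proof (induction n)
    case 0
    then show ?case by (simp add: sc_def scaleC_one)
  next
    case (Suc n)
    have "\<phi> (sc (Suc n) *\<^sub>C x) (sc (Suc n) *\<^sub>C y) (sc (Suc n) *\<^sub>C z)
        \<le> L / 8 * \<phi> (sc n *\<^sub>C x) (sc n *\<^sub>C y) (sc n *\<^sub>C z)"
      using assms(8)[of "sc (Suc n) *\<^sub>C x" "sc (Suc n) *\<^sub>C y" "sc (Suc n) *\<^sub>C z"]
      unfolding two_sc .
    also have "\<dots> \<le> L / 8 * ((L / 8) ^ n * \<phi> x y z)"
      using L Suc by (intro mult_left_mono) simp_all
    finally show ?case by simp
  qed
  \<comment> \<open>The left side is (L/4)^n, and L^n suffices for the linear estimates. The cubic
    identity has the factor 8^n instead and gives L^n exactly.\<close>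
  have scaled_bound: "2 ^ n * (L / 8) ^ n \<le> L ^ n" for n
    unfolding power_mult_distrib[symmetric] using L by (intro power_mono) simp_all
  have Ln: "(\<lambda>n. L ^ n * c) \<longlonglongrightarrow> 0" for c
    using L by (intro tendsto_mult_left_zero LIMSEQ_realpow_zero)
  have \<phi>_scaled: "2 ^ n * \<phi> (sc n *\<^sub>C x) (sc n *\<^sub>C y) (sc n *\<^sub>C z) \<le> L ^ n * \<phi> x y z" for n x y z
  proof -
    have "2 ^ n * \<phi> (sc n *\<^sub>C x) (sc n *\<^sub>C y) (sc n *\<^sub>C z) \<le> 2 ^ n * ((L / 8) ^ n * \<phi> x y z)"
      by (intro mult_left_mono \<phi>_sc) simp
    also have "\<dots> \<le> L ^ n * \<phi> x y z"
      using mult_right_mono[OF scaled_bound \<phi>_nonneg, of n x y z] by (simp add: mult.assoc)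
    finally show ?thesis .
  qed
  have nrm_pow: "B.nrm (2 ^ n *\<^sub>C v) \<le> 2 ^ n * b" if "B.nrm v \<le> b" for n v b
    using that by (simp add: B.nrm_scaleC norm_power)
  define F where "F n x = 2 ^ n *\<^sub>C f (sc n *\<^sub>C x)" for n x
  have F_step: "B.nrm (F (Suc n) x - F n x) \<le> L / 8 * \<phi> x x 0 * L ^ n" for n x
  proof -
    define w where "w = sc (Suc n) *\<^sub>C x"
    \<comment> \<open>The sum is written with the explicit scalar 1 so that the additivity bound
      applies with \<mu> = 1 and both arguments equal to w.\<close>
    have w2: "sc n *\<^sub>C x = 1 *\<^sub>C w + w"
      using two_sc[of n x] scaleC_add_left[of 1 1 w] by (simp add: w_def scaleC_one)
    have "F n x - F (Suc n) x = 2 ^ n *\<^sub>C (f (1 *\<^sub>C w + w) - 1 *\<^sub>C f w - f w)"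
      unfolding F_def w2 w_def[symmetric]
      using scaleC_add_left[of "2 ^ n" "2 ^ n" "f w"]
      by (simp add: scaleC_diff_right scaleC_one)
    then have "B.nrm (F (Suc n) x - F n x) \<le> 2 ^ n * \<phi> w w 0"
      using nrm_pow[OF f_add[of 1 w w], of n] B.nrm_minus_commute[of "F (Suc n) x" "F n x"] by simp
    \<comment> \<open>One use of the contraction passes from w to 2w and supplies the factor L/8 of
      the final constant. Writing the third argument as a scaled 0 matches the scaled bound on
      \<phi>.\<close>
    also have "\<dots> \<le> 2 ^ n * (L / 8 * \<phi> (sc n *\<^sub>C x) (sc n *\<^sub>C x) (sc n *\<^sub>C 0))"
      using assms(8)[of w w 0] by (intro mult_left_mono) (simp_all add: w_def two_sc)
    also have "\<dots> = L / 8 * (2 ^ n * \<phi> (sc n *\<^sub>C x) (sc n *\<^sub>C x) (sc n *\<^sub>C 0))"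
      by simp
    also have "\<dots> \<le> L / 8 * (L ^ n * \<phi> x x 0)"
      using L by (intro mult_left_mono \<phi>_scaled) simp
    finally show ?thesis
      by (simp add: mult_ac)
  qed
  have "\<exists>l. B.nrm_tendsto (\<lambda>n. F n x) l \<and> B.nrm (f x - l) \<le> L / (8 - 8 * L) * \<phi> x x 0" for x
  proof -
    obtain l where "B.nrm_tendsto (\<lambda>n. F n x) l"
      "B.nrm (F 0 x - l) \<le> L / 8 * \<phi> x x 0 / (1 - L)"
      by (rule B.nrm_tendsto_geometric[of "\<lambda>n. F n x", OF F_step L])
    moreover have "F 0 x = f x"
      by (simp add: F_def sc_def scaleC_one)
    \<comment> \<open>The geometric series with first term (L/8) \<phi>(x, x, 0) and ratio L gives
      exactly the required constant.\<close>
    moreover have "L / 8 * \<phi> x x 0 / (1 - L) = L / (8 - 8 * L) * \<phi> x x 0"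
      using L by (simp add: field_simps)
    ultimately show ?thesis by metis
  qed
  then obtain H where H: "\<And>x. B.nrm_tendsto (\<lambda>n. F n x) (H x)"
    and H_bound: "\<And>x. B.nrm (f x - H x) \<le> L / (8 - 8 * L) * \<phi> x x 0"
    by metis
  have H_lin: "H (\<mu> *\<^sub>C x + y) = \<mu> *\<^sub>C H x + H y" if "cmod \<mu> = 1" for \<mu> x y
  proof -
    have "B.nrm_tendsto (\<lambda>n. F n (\<mu> *\<^sub>C x + y) - \<mu> *\<^sub>C F n x - F n y)
        (H (\<mu> *\<^sub>C x + y) - \<mu> *\<^sub>C H x - H y)"
      by (intro B.nrm_tendsto_diff B.nrm_tendsto_scaleC H)
    moreover have "B.nrm (F n (\<mu> *\<^sub>C x + y) - \<mu> *\<^sub>C F n x - F n y) \<le> L ^ n * \<phi> x y 0" for n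
    proof -
      have "F n (\<mu> *\<^sub>C x + y) - \<mu> *\<^sub>C F n x - F n y
          = 2 ^ n *\<^sub>C (f (\<mu> *\<^sub>C (sc n *\<^sub>C x) + sc n *\<^sub>C y) - \<mu> *\<^sub>C f (sc n *\<^sub>C x) - f (sc n *\<^sub>C y))"
        by (simp add: F_def scaleC_add_right scaleC_diff_right scaleC_scaleC mult.commute)
      then have "B.nrm (F n (\<mu> *\<^sub>C x + y) - \<mu> *\<^sub>C F n x - F n y)
          \<le> 2 ^ n * \<phi> (sc n *\<^sub>C x) (sc n *\<^sub>C y) 0"
        using nrm_pow[OF f_add[OF that, of "sc n *\<^sub>C x" "sc n *\<^sub>C y"]] by simp
      also have "\<dots> \<le> L ^ n * \<phi> x y 0"
        using \<phi>_scaled[of n x y 0] by simp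
      finally show ?thesis .
    qed
    ultimately have "H (\<mu> *\<^sub>C x + y) - \<mu> *\<^sub>C H x - H y = 0"
      using Ln by (rule B.nrm_tendsto_eq_0)
    then show ?thesis by (simp add: algebra_simps)
  qed
  have H_add: "H (x + y) = H x + H y" for x y
    using H_lin[of 1 x y] by (simp add: scaleC_one)
  have H_unit: "H (\<mu> *\<^sub>C x) = \<mu> *\<^sub>C H x" if "cmod \<mu> = 1" for \<mu> x
    using H_lin[OF that, of x 0] H_add[of 0 0] by simp
  have H_mult: "H (actA (ipA x y) z) = actB (ipB (H x) (H y)) (H z)" for x y z
  proof -
    let ?w = "actA (ipA x y) z"
    \<comment> \<open>Scaling all three arguments by \<open>2\<^sup>-\<^sup>n\<close> scales \<open>\<langle>x, y\<rangle>z\<close> by \<open>2\<^sup>-\<^sup>3\<^sup>n\<close>.\<close>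
    have "B.nrm_tendsto (\<lambda>n. F (3 * n) ?w - actB (ipB (F n x) (F n y)) (F n z))
        (H ?w - actB (ipB (H x) (H y)) (H z))"
      by (intro B.nrm_tendsto_diff B.nrm_tendsto_act B.tendsto_ip H B.nrm_tendsto_subseq[OF H])
         (simp add: strict_mono_def)
    moreover have "B.nrm (F (3 * n) ?w - actB (ipB (F n x) (F n y)) (F n z)) \<le> L ^ n * \<phi> x y z" for n
    proof -
      let ?x = "sc n *\<^sub>C x" and ?y = "sc n *\<^sub>C y" and ?z = "sc n *\<^sub>C z"
      have cnj_sc: "cnj (sc n) = sc n"
        by (simp add: sc_def)
      have "actA (ipA ?x ?y) ?z = sc (3 * n) *\<^sub>C ?w"
        by (simp add: A.ip_scaleC_left A.ip_scaleC_right cnj_sc scaleC_scaleC sc_add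
            flip: A.scaleC_act_left A.scaleC_act_right) (simp add: numeral_3_eq_3 add.assoc)
      moreover have "actB (ipB (F n x) (F n y)) (F n z)
          = 2 ^ (3 * n) *\<^sub>C actB (ipB (f ?x) (f ?y)) (f ?z)"
        by (simp add: F_def B.ip_scaleC_left B.ip_scaleC_right scaleC_scaleC
            flip: B.scaleC_act_left B.scaleC_act_right power_add)
           (simp add: numeral_3_eq_3 add.assoc)
      ultimately have "F (3 * n) ?w - actB (ipB (F n x) (F n y)) (F n z)
          = 2 ^ (3 * n) *\<^sub>C (f (actA (ipA ?x ?y) ?z) - actB (ipB (f ?x) (f ?y)) (f ?z))"
        by (simp add: F_def scaleC_diff_right)
      then have "B.nrm (F (3 * n) ?w - actB (ipB (F n x) (F n y)) (F n z))
          \<le> 8 ^ n * \<phi> ?x ?y ?z"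
        using nrm_pow[OF f_mult[of ?x ?y ?z], of "3 * n"] by (simp add: power_mult)
      \<comment> \<open>The growth 8^n from the cubic scaling is cancelled exactly by the n-fold
        contraction.\<close>
      also have "\<dots> \<le> 8 ^ n * ((L / 8) ^ n * \<phi> x y z)"
        by (intro mult_left_mono \<phi>_sc) simp
      also have "\<dots> = L ^ n * \<phi> x y z"
        by (simp add: power_divide)
      finally show ?thesis .
    qed
    ultimately have "H ?w - actB (ipB (H x) (H y)) (H z) = 0"
      using Ln by (rule B.nrm_tendsto_eq_0)
    then show ?thesis by simp
  qed
  have H_hom: "hilbert_module_hom actA ipA actB ipB H"
    unfolding hilbert_module_hom_def
    using H_add H_mult additive_unit_homogeneous_imp_homogeneous[of H, OF H_add H_unit] by blast
  have unique: "K = H" if K: "hilbert_module_hom actA ipA actB ipB K"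
    and K_bound: "\<And>x. B.nrm (f x - K x) \<le> L / (8 - 8 * L) * \<phi> x x 0" for K
  proof
    fix x
    define C where "C = L / (8 - 8 * L)"
    have C: "0 \<le> C"
      using L by (simp add: C_def)
    \<comment> \<open>A homomorphism is fixed by the rescaling that defines F, so its distance from
      F n x is the rescaled distance between f and K at the shrunken point, which tends to
      0.\<close>
    have K_F: "2 ^ n *\<^sub>C K (sc n *\<^sub>C x) = K x" for n
      using K pow_sc[of n] by (simp add: hilbert_module_hom_def scaleC_scaleC scaleC_one)
    have lim: "B.nrm_tendsto (\<lambda>n. F n x - K x) (H x - K x)"
      by (intro B.nrm_tendsto_diff H) (simp add: B.nrm_tendsto_def)
    have le: "B.nrm (F n x - K x) \<le> L ^ n * (C * \<phi> x x 0)" for n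
    proof -
      have "F n x - K x = 2 ^ n *\<^sub>C (f (sc n *\<^sub>C x) - K (sc n *\<^sub>C x))"
        by (simp add: F_def scaleC_diff_right K_F)
      then have "B.nrm (F n x - K x) \<le> 2 ^ n * (C * \<phi> (sc n *\<^sub>C x) (sc n *\<^sub>C x) 0)"
        using nrm_pow[OF K_bound[of "sc n *\<^sub>C x"]] by (simp add: C_def)
      also have "\<dots> = C * (2 ^ n * \<phi> (sc n *\<^sub>C x) (sc n *\<^sub>C x) (sc n *\<^sub>C 0))"
        by simp
      also have "\<dots> \<le> C * (L ^ n * \<phi> x x 0)"
        by (intro mult_left_mono \<phi>_scaled C)
      finally show ?thesis by (simp add: mult_ac)
    qed
    have "H x - K x = 0"
      by (rule B.nrm_tendsto_eq_0[OF lim le Ln])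
    then show "K x = H x" by simp
  qed
  show ?thesis
  proof (rule ex1I[of _ H])
    show "hilbert_module_hom actA ipA actB ipB H \<and>
        (\<forall>x. B.nrm (f x - H x) \<le> L / (8 - 8 * L) * \<phi> x x 0)"
      using H_hom H_bound by blast
  qed (use unique in blast)
qed

end
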